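(* Let $\Gamma$ be a finite graph, for each vertex $i$ of $\Gamma$ let $G_i$ be a finitely presented group, and let $G$ be the graph product of the groups $G_i$ over $\Gamma$. Then: (a) for every integer $k>1$, if each vertex group $G_i$ has an isoperimetric function which is polynomial of degree $k$, then $G$ has an isoperimetric function which is polynomial of degree $k$; (b) if each vertex group $G_i$ has an exponential isoperimetric function, then $G$ has an exponential isoperimetric function.
   Context: Graph: a finite graph $\Gamma$ consists of a finite set of vertices and a finite set of edges, each edge being an unordered pair of (distinct) vertices. Graph product: given a group $G_i$ for each vertex $i$ of $\Gamma$, the graph product $G$ is the quotient of the free product of the $G_i$ by the smallest normal subgroup containing all commutators $[g,h]$ with $g\in G_i$, $h\in G_j$, where $i$ and $j$ are joined by an edge. If $G_i$ has a finite presentation $\langle A_i;R_i\rangle$ with the $A_i$ disjoint, then $G$ has the finite presentation $\langle \bigcup A_i;\ \bigcup R_i\cup S\rangle$, where $S$ is the set of commutators $[a,b]$ with $a\in A_i$, $b\in A_j$ and $i,j$ joined by an edge. Isoperimetric function: let $\langle Y;S\rangle$ be a finite presentation of a group $H$. A function $f:\mathbb{N}\to[0,\infty)$ is an isoperimetric function for the presentation if, whenever $w$ is a word of length $n$ in the free group on $Y$ which equals $1$ in $H$, the element $w$ of the free group is a product of at most $f(n)$ conjugates of elements of $S$ and their inverses. Independence of presentation: if a finite presentation of $H$ has isoperimetric function $f$, then for any other finite presentation of $H$ there are positive constants $a,b,c,d,e$ such that $n\mapsto af(bn+c)+dn+e$ is an isoperimetric function for it. Isoperimetric functions are considered up to the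 equivalence generated by this: $g\preceq f$ if there are positive constants $a,\dots,e$ with $g(n)\le af(bn+c)+dn+e$ for all $n$, and $f,g$ are equivalent if $g\preceq f$ and $f\preceq g$; all polynomials of a given degree are equivalent, and all exponentials are equivalent. A finitely presented group "has an isoperimetric function which is polynomial of degree $k$" (respectively "has an exponential isoperimetric function") if some, equivalently every, finite presentation of it has an isoperimetric function that is a polynomial of degree $k$ (respectively a function of the form $n\mapsto C\cdot B^n$ with constants $C>0$, $B>1$). *)

theory Defs
  imports Complex_Main "HOL-Algebra.Coset" "HOL-Computational_Algebra.Polynomial"
begin

inductive_set word_cong :: "'x set \<Rightarrow> ('x list \<times> 'x list) set \<Rightarrow> ('x list \<times> 'x list) set"
  for A :: "'x set" and R :: "('x list \<times> 'x list) set"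
where
  step: "\<lbrakk>(u, v) \<in> R; p \<in> lists A; q \<in> lists A; u \<in> lists A; v \<in> lists A\<rbrakk>
           \<Longrightarrow> (p @ u @ q, p @ v @ q) \<in> word_cong A R"
| refl: "w \<in> lists A \<Longrightarrow> (w, w) \<in> word_cong A R"
| sym: "(v, w) \<in> word_cong A R \<Longrightarrow> (w, v) \<in> word_cong A R"
| trans: "\<lbrakk>(u, v) \<in> word_cong A R; (v, w) \<in> word_cong A R\<rbrakk> \<Longrightarrow> (u, w) \<in> word_cong A R"

definition word_class :: "'x set \<Rightarrow> ('x list \<times> 'x list) set \<Rightarrow> 'x list \<Rightarrow> 'x list set" where
  "word_class A R w = word_cong A R `` {w}"

definition word_quotient :: "'x set \<Rightarrow> ('x list \<times> 'x list) set \<Rightarrow> 'x list set monoid" where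
  "word_quotient A R =
     \<lparr>carrier = lists A // word_cong A R,
      monoid.mult = (\<lambda>P Q. \<Union>p\<in>P. \<Union>q\<in>Q. word_class A R (p @ q)),
      one = word_class A R []\<rparr>"

text \<open>The letter \<open>(y, True)\<close> stands for the generator \<open>y\<close> and \<open>(y, False)\<close> for its formal inverse.\<close>

definition free_letters :: "'y set \<Rightarrow> ('y \<times> bool) set" where
  "free_letters Y = Y \<times> UNIV"

definition free_cancel :: "'y set \<Rightarrow> (('y \<times> bool) list \<times> ('y \<times> bool) list) set" where
  "free_cancel Y = {([(y, b), (y, \<not> b)], []) | y b. y \<in> Y}"

definition free_group :: "'y set \<Rightarrow> ('y \<times> bool) list set monoid" where
  "free_group Y = word_quotient (free_letters Y) (free_cancel Y)"

definition free_word :: "'y set \<Rightarrow> ('y \<times> bool) list \<Rightarrow> ('y \<times> bool) list set" where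
  "free_word Y w = word_class (free_letters Y) (free_cancel Y) w"

definition product_letters :: "'i set \<Rightarrow> ('i \<Rightarrow> ('a, 'm) monoid_scheme) \<Rightarrow> ('i \<times> 'a) set" where
  "product_letters I G = (SIGMA i:I. carrier (G i))"

definition product_rels ::
  "'i set \<Rightarrow> ('i \<Rightarrow> ('a, 'm) monoid_scheme) \<Rightarrow> (('i \<times> 'a) list \<times> ('i \<times> 'a) list) set" where
  "product_rels I G =
     {([(i, \<one>\<^bsub>G i\<^esub>)], []) | i. i \<in> I} \<union>
     {([(i, g), (i, h)], [(i, g \<otimes>\<^bsub>G i\<^esub> h)]) | i g h. i \<in> I \<and> g \<in> carrier (G i) \<and> h \<in> carrier (G i)}"

definition free_product ::
  "'i set \<Rightarrow> ('i \<Rightarrow> ('a, 'm) monoid_scheme) \<Rightarrow> ('i \<times> 'a) list set monoid" where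
  "free_product I G = word_quotient (product_letters I G) (product_rels I G)"

definition free_product_incl ::
  "'i set \<Rightarrow> ('i \<Rightarrow> ('a, 'm) monoid_scheme) \<Rightarrow> 'i \<Rightarrow> 'a \<Rightarrow> ('i \<times> 'a) list set" where
  "free_product_incl I G i g = word_class (product_letters I G) (product_rels I G) [(i, g)]"

definition normal_closure :: "('a, 'm) monoid_scheme \<Rightarrow> 'a set \<Rightarrow> 'a set" where
  "normal_closure G S = \<Inter>{N. N \<lhd> G \<and> S \<subseteq> N}"

definition commutator :: "('a, 'm) monoid_scheme \<Rightarrow> 'a \<Rightarrow> 'a \<Rightarrow> 'a" where
  "commutator G g h = g \<otimes>\<^bsub>G\<^esub> h \<otimes>\<^bsub>G\<^esub> inv\<^bsub>G\<^esub> g \<otimes>\<^bsub>G\<^esub> inv\<^bsub>G\<^esub> h"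

definition finite_graph :: "'v set \<Rightarrow> 'v set set \<Rightarrow> bool" where
  "finite_graph V E \<longleftrightarrow>
     finite V \<and> finite E \<and> (\<forall>e\<in>E. \<exists>i\<in>V. \<exists>j\<in>V. i \<noteq> j \<and> e = {i, j})"

definition graph_product ::
  "'v set \<Rightarrow> 'v set set \<Rightarrow> ('v \<Rightarrow> ('a, 'm) monoid_scheme) \<Rightarrow> ('v \<times> 'a) list set set monoid" where
  "graph_product V E G =
     free_product V G Mod
       normal_closure (free_product V G)
         {commutator (free_product V G) (free_product_incl V G i g) (free_product_incl V G j h)
           | i j g h. i \<in> V \<and> j \<in> V \<and> {i, j} \<in> E \<and> g \<in> carrier (G i) \<and> h \<in> carrier (G j)}"

definition presented_group ::
  "'y set \<Rightarrow> ('y \<times> bool) list set set \<Rightarrow> ('y \<times> bool) list set set monoid" where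
  "presented_group Y S = free_group Y Mod normal_closure (free_group Y) S"

definition finite_presentation ::
  "'y set \<Rightarrow> ('y \<times> bool) list set set \<Rightarrow> ('a, 'm) monoid_scheme \<Rightarrow> bool" where
  "finite_presentation Y S H \<longleftrightarrow>
     finite Y \<and> finite S \<and> S \<subseteq> carrier (free_group Y) \<and> presented_group Y S \<cong> H"

definition conjugates :: "('a, 'm) monoid_scheme \<Rightarrow> 'a set \<Rightarrow> 'a set" where
  "conjugates G T = {c \<otimes>\<^bsub>G\<^esub> t \<otimes>\<^bsub>G\<^esub> inv\<^bsub>G\<^esub> c | c t. c \<in> carrier G \<and> t \<in> T}"

definition is_product_of_at_most :: "('a, 'm) monoid_scheme \<Rightarrow> 'a set \<Rightarrow> real \<Rightarrow> 'a \<Rightarrow> bool" where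
  "is_product_of_at_most G T r x \<longleftrightarrow>
     (\<exists>xs. set xs \<subseteq> T \<and> real (length xs) \<le> r \<and> x = foldr (\<otimes>\<^bsub>G\<^esub>) xs \<one>\<^bsub>G\<^esub>)"

text \<open>Words need not be reduced.\<close>

definition isoperimetric_function ::
  "'y set \<Rightarrow> ('y \<times> bool) list set set \<Rightarrow> (nat \<Rightarrow> real) \<Rightarrow> bool" where
  "isoperimetric_function Y S f \<longleftrightarrow>
     (\<forall>n. 0 \<le> f n) \<and>
     (\<forall>w \<in> lists (free_letters Y).
        normal_closure (free_group Y) S #>\<^bsub>free_group Y\<^esub> free_word Y w = \<one>\<^bsub>presented_group Y S\<^esub>
        \<longrightarrow> is_product_of_at_most (free_group Y)
              (conjugates (free_group Y) (S \<union> (\<lambda>s. inv\<^bsub>free_group Y\<^esub> s) ` S))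
              (f (length w)) (free_word Y w))"

text \<open>Any finite set of generators can be renamed to a set of natural numbers, so generators of
  type \<^typ>\<open>nat\<close> lose no generality in quantifying over finite presentations.\<close>

definition finitely_presented :: "('a, 'm) monoid_scheme \<Rightarrow> bool" where
  "finitely_presented H \<longleftrightarrow> (\<exists>(Y :: nat set) S. finite_presentation Y S H)"

definition has_isoperimetric_function :: "('a, 'm) monoid_scheme \<Rightarrow> (nat \<Rightarrow> real) \<Rightarrow> bool" where
  "has_isoperimetric_function H f \<longleftrightarrow>
     (\<exists>(Y :: nat set) S. finite_presentation Y S H \<and> isoperimetric_function Y S f)"

definition has_polynomial_isoperimetric_function :: "('a, 'm) monoid_scheme \<Rightarrow> nat \<Rightarrow> bool" where
  "has_polynomial_isoperimetric_function H k \<longleftrightarrow>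
     (\<exists>p :: real poly. degree p = k \<and> has_isoperimetric_function H (\<lambda>n. poly p (real n)))"

definition has_exponential_isoperimetric_function :: "('a, 'm) monoid_scheme \<Rightarrow> bool" where
  "has_exponential_isoperimetric_function H \<longleftrightarrow>
     (\<exists>C B :: real. C > 0 \<and> B > 1 \<and> has_isoperimetric_function H (\<lambda>n. C * B ^ n))"

end

theory Submission
  imports Defs "HOL-Library.Nat_Bijection"
begin

text \<open>Read a word letter by letter from the right, keeping a word of syllables (words over single
  vertex presentations) that represents a reduced element of the graph product. A new letter of
  vertex \<open>i\<close> moves right past syllables at vertices adjacent to \<open>i\<close> into a syllable at \<open>i\<close> if it can,
  and otherwise forms a new syllable; if the resulting syllable is trivial in \<open>G i\<close>, it is deleted
  at the cost allowed by the isoperimetric function of \<open>G i\<close>, and what remains is still reduced.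
  The moves cost at most \<open>n\<^sup>2\<close> in total, and the deleted syllables have total length at most \<open>n\<close>,
  so a superadditive bound \<open>F\<close> of the vertex functions gives \<open>n\<^sup>2 + F n\<close>. By the normal form
  theorem, proved by letting the graph product act on normal forms, nothing remains at the end if
  the word represents the identity. The same argument shows that the kernel of the evaluation map
  is the normal closure of the relators.\<close>

text \<open>The quadratic term cannot be avoided, whence k > 1 in (a): two infinite cyclic groups
  joined by an edge have linear isoperimetric functions, but their product needs a quadratic one. A
  syllable is kept as a word and not as an element of its vertex group, because the isoperimetric
  function prices a deletion by the length of the word deleted. \<open>F\<close> must be
  superadditive so that the prices of many short deletions combine into one. It dominates the vertex
  functions at positive arguments only: superadditivity and nonnegativity force F 0 = 0, whereas a
  vertex function may be positive at 0. Only nonempty syllables are ever deleted. The words are read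
  from the right because the group acts on normal forms from the left: absorbing a letter is the
  action of its value. So the rewriting can carry the invariant that its syllables describe the
  image of the empty normal form, and a word acting trivially leaves no syllable behind. The action
  exists because, for each vertex i, a normal form is a pair of an element of \<open>G i\<close> at
  its front and a rest, and \<open>G i\<close> can translate the first coordinate.\<close>

text \<open>These rules would replace membership in \<open>lists A\<close>, which the simplifier handles well, by
  statements about single letters.\<close>

declare in_listsI [rule del] in_listsD [rule del]

section \<open>Quotients of word monoids by congruences\<close>

lemma word_cong_lists: "(u, v) \<in> word_cong A R \<Longrightarrow> u \<in> lists A \<and> v \<in> lists A"
  by (induction rule: word_cong.induct) auto

lemma equiv_word_cong: "equiv (lists A) (word_cong A R)"
proof (rule equivI)
  show "word_cong A R \<subseteq> lists A \<times> lists A" using word_cong_lists[of _ _ A R] by auto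
  show "refl_on (lists A) (word_cong A R)" by (auto intro!: refl_onI word_cong.refl)
  show "sym (word_cong A R)" by (auto intro!: symI word_cong.sym)
  show "trans (word_cong A R)" by (auto intro!: transI intro: word_cong.trans)
qed

lemma word_cong_append_left:
  "(u, v) \<in> word_cong A R \<Longrightarrow> p \<in> lists A \<Longrightarrow> (p @ u, p @ v) \<in> word_cong A R"
proof (induction rule: word_cong.induct)
  case (step u v p' q)
  then show ?case using word_cong.step[of u v R "p @ p'" A q] by auto
next
  case (refl w)
  then show ?case by (simp add: word_cong.refl)
next
  case (sym v w)
  then show ?case by (simp add: word_cong.sym)
next
  case (trans u v w)
  then show ?case by (meson word_cong.trans)
qed

lemma word_cong_append_right:
  "(u, v) \<in> word_cong A R \<Longrightarrow> q \<in> lists A \<Longrightarrow> (u @ q, v @ q) \<in> word_cong A R"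
proof (induction rule: word_cong.induct)
  case (step u v p q')
  then show ?case using word_cong.step[of u v R p A "q' @ q"] by auto
next
  case (refl w)
  then show ?case by (simp add: word_cong.refl)
next
  case (sym v w)
  then show ?case by (simp add: word_cong.sym)
next
  case (trans u v w)
  then show ?case by (meson word_cong.trans)
qed

lemma word_cong_append:
  assumes "(u, u') \<in> word_cong A R" "(v, v') \<in> word_cong A R"
  shows "(u @ v, u' @ v') \<in> word_cong A R"
proof (rule word_cong.trans)
  show "(u @ v, u' @ v) \<in> word_cong A R"
    using assms word_cong_lists[OF assms(2)] by (simp add: word_cong_append_right)
  show "(u' @ v, u' @ v') \<in> word_cong A R"
    using assms word_cong_lists[OF assms(1)] by (simp add: word_cong_append_left)
qed

lemma word_class_eq_iff:
  "u \<in> lists A \<Longrightarrow> v \<in> lists A \<Longrightarrow>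
    word_class A R u = word_class A R v \<longleftrightarrow> (u, v) \<in> word_cong A R"
  unfolding word_class_def by (rule eq_equiv_class_iff[OF equiv_word_cong])

lemma mem_word_class: "v \<in> word_class A R w \<longleftrightarrow> (w, v) \<in> word_cong A R"
  by (simp add: word_class_def)

lemma carrier_word_quotient: "carrier (word_quotient A R) = word_class A R ` lists A"
  by (auto simp: word_quotient_def word_class_def quotient_def)

lemma one_word_quotient: "\<one>\<^bsub>word_quotient A R\<^esub> = word_class A R []"
  by (simp add: word_quotient_def)

lemma mult_word_class:
  assumes "u \<in> lists A" "v \<in> lists A"
  shows "word_class A R u \<otimes>\<^bsub>word_quotient A R\<^esub> word_class A R v = word_class A R (u @ v)"
proof -
  have "word_class A R (p @ q) = word_class A R (u @ v)"
    if "p \<in> word_class A R u" "q \<in> word_class A R v" for p q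
  proof -
    have "(u @ v, p @ q) \<in> word_cong A R"
      using that by (intro word_cong_append) (simp_all add: mem_word_class)
    then show ?thesis using word_class_eq_iff word_cong_lists by metis
  qed
  moreover have "u \<in> word_class A R u" "v \<in> word_class A R v"
    using assms by (auto simp: mem_word_class intro: word_cong.refl)
  ultimately have "(\<Union>p\<in>word_class A R u. \<Union>q\<in>word_class A R v. word_class A R (p @ q)) =
      word_class A R (u @ v)"
    by blast
  then show ?thesis
    by (simp add: word_quotient_def)
qed

lemma word_class_closed [simp]:
  "w \<in> lists A \<Longrightarrow> word_class A R w \<in> carrier (word_quotient A R)"
  by (simp add: carrier_word_quotient)

lemma monoid_word_quotient: "Group.monoid (word_quotient A R)"
proof (rule monoidI, goal_cases)
  case (1 x y)
  then show ?case by (auto simp: carrier_word_quotient mult_word_class)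
next
  case 2
  show ?case by (auto simp: carrier_word_quotient one_word_quotient)
next
  case (3 x y z)
  then show ?case by (auto simp: carrier_word_quotient mult_word_class)
next
  case (4 x)
  then show ?case by (auto simp: carrier_word_quotient one_word_quotient mult_word_class)
next
  case (5 x)
  then show ?case by (auto simp: carrier_word_quotient one_word_quotient mult_word_class)
qed

text \<open>Left inverses of single letters suffice: if \<open>v\<close> and \<open>b\<close> are
  left inverses of \<open>w\<close> and \<open>[a]\<close>, then \<open>v @ b\<close> is one of
  \<open>a # w\<close>.\<close>

lemma group_word_quotient:
  assumes "\<And>a. a \<in> A \<Longrightarrow> \<exists>v\<in>lists A. (v @ [a], []) \<in> word_cong A R"
  shows "Group.group (word_quotient A R)"
proof -
  have inv: "\<exists>v\<in>lists A. (v @ w, []) \<in> word_cong A R" if "w \<in> lists A" for w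
    using that
  proof (induction w)
    case Nil
    then show ?case by (intro bexI[of _ "[]"]) (auto intro: word_cong.refl)
  next
    case (Cons a w)
    then obtain v where v: "v \<in> lists A" "(v @ w, []) \<in> word_cong A R" by auto
    obtain b where b: "b \<in> lists A" "(b @ [a], []) \<in> word_cong A R" using assms Cons by blast
    have "(v @ (b @ [a]) @ w, v @ [] @ w) \<in> word_cong A R"
      using b v Cons by (intro word_cong_append_left word_cong_append_right) auto
    then have "((v @ b) @ a # w, []) \<in> word_cong A R"
      using v(2) by (auto intro: word_cong.trans)
    then show ?case using v b by (intro bexI[of _ "v @ b"]) auto
  qed
  interpret Group.monoid "word_quotient A R" by (rule monoid_word_quotient)
  show ?thesis
  proof (rule groupI)
    fix x assume "x \<in> carrier (word_quotient A R)"
    then obtain w where w: "w \<in> lists A" "x = word_class A R w"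
      by (auto simp: carrier_word_quotient)
    obtain v where "v \<in> lists A" "(v @ w, []) \<in> word_cong A R" using inv w by blast
    with w show "\<exists>y\<in>carrier (word_quotient A R). y \<otimes>\<^bsub>word_quotient A R\<^esub> x = \<one>\<^bsub>word_quotient A R\<^esub>"
      by (intro bexI[of _ "word_class A R v"])
        (auto simp: mult_word_class one_word_quotient word_class_eq_iff)
  qed (auto simp: m_assoc)
qed

section \<open>Evaluation of words and homomorphisms out of word quotients\<close>

definition word_eval :: "('b, 'm) monoid_scheme \<Rightarrow> ('x \<Rightarrow> 'b) \<Rightarrow> 'x list \<Rightarrow> 'b" where
  "word_eval H f w = foldr (\<lambda>a h. f a \<otimes>\<^bsub>H\<^esub> h) w \<one>\<^bsub>H\<^esub>"

lemma word_eval_simps [simp]: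
  "word_eval H f [] = \<one>\<^bsub>H\<^esub>"
  "word_eval H f (a # w) = f a \<otimes>\<^bsub>H\<^esub> word_eval H f w"
  by (simp_all add: word_eval_def)

lemma (in Group.monoid) word_eval_closed:
  "f \<in> A \<rightarrow> carrier G \<Longrightarrow> w \<in> lists A \<Longrightarrow> word_eval G f w \<in> carrier G"
  by (induction w) auto

lemma (in Group.monoid) word_eval_append:
  "f \<in> A \<rightarrow> carrier G \<Longrightarrow> u \<in> lists A \<Longrightarrow> v \<in> lists A \<Longrightarrow>
    word_eval G f (u @ v) = word_eval G f u \<otimes> word_eval G f v"
  by (induction u) (auto simp: word_eval_closed m_assoc Pi_iff)

lemma word_class_eq_eval:
  "w \<in> lists A \<Longrightarrow> word_class A R w = word_eval (word_quotient A R) (\<lambda>a. word_class A R [a]) w"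
proof (induction w)
  case (Cons a w)
  then show ?case using mult_word_class[of "[a]" A w R] by auto
qed (auto simp: one_word_quotient)

text \<open>The universal property from which the homomorphisms out of free groups and out of the
  free product are both obtained.\<close>

lemma word_quotient_lift:
  assumes H: "Group.monoid H" and f: "f \<in> A \<rightarrow> carrier H"
    and R: "\<And>u v. (u, v) \<in> R \<Longrightarrow> u \<in> lists A \<Longrightarrow> v \<in> lists A \<Longrightarrow> word_eval H f u = word_eval H f v"
  shows "\<exists>\<phi>\<in>hom (word_quotient A R) H. \<forall>w\<in>lists A. \<phi> (word_class A R w) = word_eval H f w"
proof -
  interpret Group.monoid H by (rule H)
  have cong: "word_eval H f u = word_eval H f v" if "(u, v) \<in> word_cong A R" for u v
    using that
  proof induction
    case (step u v p q)
    then show ?case using R[of u v] f by (simp add: word_eval_append[OF f])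
  qed auto
  define \<phi> where "\<phi> X = word_eval H f (SOME w. w \<in> X)" for X
  have *: "\<phi> (word_class A R w) = word_eval H f w" if "w \<in> lists A" for w
  proof -
    have "w \<in> word_class A R w" using that by (auto simp: mem_word_class intro: word_cong.refl)
    then have "(SOME v. v \<in> word_class A R w) \<in> word_class A R w" by (rule someI)
    then show ?thesis using cong by (auto simp: \<phi>_def mem_word_class)
  qed
  have "\<phi> \<in> hom (word_quotient A R) H"
    by (rule homI)
      (auto simp: carrier_word_quotient mult_word_class * word_eval_append[OF f] word_eval_closed[OF f])
  with * show ?thesis by blast
qed

section \<open>Free groups\<close>

lemma mem_free_letters [simp]: "(y, b) \<in> free_letters Y \<longleftrightarrow> y \<in> Y"
  by (simp add: free_letters_def)

lemma free_cancel_cong: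
  "y \<in> Y \<Longrightarrow> ([(y, b), (y, \<not> b)], []) \<in> word_cong (free_letters Y) (free_cancel Y)"
proof -
  assume "y \<in> Y"
  then have "([] @ [(y, b), (y, \<not> b)] @ [], [] @ [] @ []) \<in> word_cong (free_letters Y) (free_cancel Y)"
    by (intro word_cong.step) (auto simp: free_cancel_def)
  then show ?thesis by simp
qed

lemma group_free_group: "Group.group (free_group Y)"
  unfolding free_group_def
proof (rule group_word_quotient)
  fix a assume "a \<in> free_letters Y"
  then obtain y b where a: "a = (y, b)" "y \<in> Y" by (auto simp: free_letters_def)
  show "\<exists>v\<in>lists (free_letters Y). (v @ [a], []) \<in> word_cong (free_letters Y) (free_cancel Y)"
    using free_cancel_cong[OF a(2), of "\<not> b"] a
    by (intro bexI[of _ "[(y, \<not> b)]"]) simp_all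
qed

lemma free_word_closed [simp]:
  "w \<in> lists (free_letters Y) \<Longrightarrow> free_word Y w \<in> carrier (free_group Y)"
  by (simp add: free_word_def free_group_def)

lemma carrier_free_group: "carrier (free_group Y) = free_word Y ` lists (free_letters Y)"
  by (simp add: free_word_def[abs_def] free_group_def carrier_word_quotient)

lemma one_free_group: "\<one>\<^bsub>free_group Y\<^esub> = free_word Y []"
  by (simp add: free_word_def free_group_def one_word_quotient)

lemma free_word_append:
  "u \<in> lists (free_letters Y) \<Longrightarrow> v \<in> lists (free_letters Y) \<Longrightarrow>
    free_word Y (u @ v) = free_word Y u \<otimes>\<^bsub>free_group Y\<^esub> free_word Y v"
  by (simp add: free_word_def free_group_def mult_word_class)

lemma inv_free_letter:
  assumes "y \<in> Y"
  shows "inv\<^bsub>free_group Y\<^esub> free_word Y [(y, b)] = free_word Y [(y, \<not> b)]"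
proof -
  interpret group "free_group Y" by (rule group_free_group)
  have m: "[(y, c)] \<in> lists (free_letters Y)" for c using assms by simp
  have "free_word Y [(y, \<not> b)] \<otimes>\<^bsub>free_group Y\<^esub> free_word Y [(y, b)] = \<one>\<^bsub>free_group Y\<^esub>"
    unfolding free_word_append[OF m m, symmetric] one_free_group
    unfolding free_word_def using m[of b] m[of "\<not> b"] free_cancel_cong[OF assms, of "\<not> b"]
    by (subst word_class_eq_iff) simp_all
  then show ?thesis using m by (intro inv_equality free_word_closed)
qed

lemma free_group_lift:
  assumes H: "Group.group H" and f: "f \<in> free_letters Y \<rightarrow> carrier H"
    and inv: "\<And>y b. y \<in> Y \<Longrightarrow> f (y, b) \<otimes>\<^bsub>H\<^esub> f (y, \<not> b) = \<one>\<^bsub>H\<^esub>"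
  shows "\<exists>\<phi>\<in>hom (free_group Y) H. \<forall>w\<in>lists (free_letters Y). \<phi> (free_word Y w) = word_eval H f w"
proof -
  interpret group H by (rule H)
  have "word_eval H f u = word_eval H f v" if "(u, v) \<in> free_cancel Y" for u v
  proof -
    obtain y b where *: "u = [(y, b), (y, \<not> b)]" "v = []" "y \<in> Y"
      using \<open>(u, v) \<in> free_cancel Y\<close> by (auto simp: free_cancel_def)
    then have "f (y, b) \<in> carrier H" "f (y, \<not> b) \<in> carrier H" using f by auto
    with * show ?thesis using inv[OF *(3), of b] by simp
  qed
  then show ?thesis
    unfolding free_word_def free_group_def by (intro word_quotient_lift[OF is_monoid f])
qed

section \<open>Products of conjugates\<close>

lemma (in group) foldr_mult_closed: "set xs \<subseteq> carrier G \<Longrightarrow> foldr (\<otimes>) xs \<one> \<in> carrier G"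
  by (induction xs) auto

lemma (in group) inv_mult_cancel:
  "x \<in> carrier G \<Longrightarrow> y \<in> carrier G \<Longrightarrow> inv x \<otimes> (x \<otimes> y) = y"
  "x \<in> carrier G \<Longrightarrow> y \<in> carrier G \<Longrightarrow> x \<otimes> (inv x \<otimes> y) = y"
  by (simp_all flip: m_assoc)

lemma (in group) foldr_mult_append:
  "set xs \<subseteq> carrier G \<Longrightarrow> set ys \<subseteq> carrier G \<Longrightarrow>
    foldr (\<otimes>) (xs @ ys) \<one> = foldr (\<otimes>) xs \<one> \<otimes> foldr (\<otimes>) ys \<one>"
  by (induction xs) (auto simp: m_assoc foldr_mult_closed)

lemma conjugatesE:
  assumes "x \<in> conjugates G T"
  obtains c t where "c \<in> carrier G" "t \<in> T" "x = c \<otimes>\<^bsub>G\<^esub> t \<otimes>\<^bsub>G\<^esub> inv\<^bsub>G\<^esub> c"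
  using assms unfolding conjugates_def by blast

lemma conjugatesI:
  "c \<in> carrier G \<Longrightarrow> t \<in> T \<Longrightarrow> c \<otimes>\<^bsub>G\<^esub> t \<otimes>\<^bsub>G\<^esub> inv\<^bsub>G\<^esub> c \<in> conjugates G T"
  unfolding conjugates_def by blast

lemma (in group) conjugates_subset: "T \<subseteq> carrier G \<Longrightarrow> conjugates G T \<subseteq> carrier G"
  by (auto simp: conjugates_def)

lemma (in group) conjugates_conj:
  assumes "T \<subseteq> carrier G" "x \<in> conjugates G T" "c \<in> carrier G"
  shows "c \<otimes> x \<otimes> inv c \<in> conjugates G T"
proof -
  obtain d t where d: "d \<in> carrier G" "t \<in> T" "x = d \<otimes> t \<otimes> inv d"
    using assms by (auto simp: conjugates_def)
  then have "c \<otimes> x \<otimes> inv c = (c \<otimes> d) \<otimes> t \<otimes> inv (c \<otimes> d)"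
    using assms by (auto simp: m_assoc inv_mult_group)
  then show ?thesis using d assms unfolding conjugates_def by blast
qed

lemma (in group) is_product_mult:
  assumes "T \<subseteq> carrier G" "is_product_of_at_most G T r x" "is_product_of_at_most G T s y"
  shows "is_product_of_at_most G T (r + s) (x \<otimes> y)"
proof -
  obtain xs ys where *: "set xs \<subseteq> T" "real (length xs) \<le> r" "x = foldr (\<otimes>) xs \<one>"
    "set ys \<subseteq> T" "real (length ys) \<le> s" "y = foldr (\<otimes>) ys \<one>"
    using assms unfolding is_product_of_at_most_def by metis
  then have "foldr (\<otimes>) (xs @ ys) \<one> = x \<otimes> y" using foldr_mult_append[of xs ys] assms(1) by simp
  then show ?thesis unfolding is_product_of_at_most_def
    using * by (intro exI[of _ "xs @ ys"]) auto
qed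

text \<open>Conjugation by \<open>c\<close> distributes over the factors, and a conjugate of a
  conjugate is a conjugate, so the number of factors does not change.\<close>

lemma (in group) is_product_conj:
  assumes "T \<subseteq> carrier G" "is_product_of_at_most G (conjugates G T) r x" "c \<in> carrier G"
  shows "is_product_of_at_most G (conjugates G T) r (c \<otimes> x \<otimes> inv c)"
proof -
  obtain xs where *: "set xs \<subseteq> conjugates G T" "real (length xs) \<le> r" "x = foldr (\<otimes>) xs \<one>"
    using assms unfolding is_product_of_at_most_def by metis
  let ?f = "\<lambda>x. c \<otimes> x \<otimes> inv c"
  have "foldr (\<otimes>) (map ?f xs) \<one> = ?f (foldr (\<otimes>) xs \<one>)"
    using *(1)
  proof (induction xs)
    case (Cons a xs)
    then have "a \<in> carrier G" "set xs \<subseteq> carrier G" "foldr (\<otimes>) xs \<one> \<in> carrier G"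
      using conjugates_subset[OF assms(1)] by (auto intro!: foldr_mult_closed)
    then show ?case using Cons assms(3)
      by (simp add: m_assoc inv_mult_cancel)
  qed (use assms in auto)
  then show ?thesis unfolding is_product_of_at_most_def
    using * conjugates_conj[OF assms(1) _ assms(3)] by (intro exI[of _ "map ?f xs"]) auto
qed

lemma is_product_mono:
  "is_product_of_at_most G T r x \<Longrightarrow> r \<le> s \<Longrightarrow> is_product_of_at_most G T s x"
  unfolding is_product_of_at_most_def by (elim exE, rule_tac x = xs in exI) auto

text \<open>This carries the isoperimetric inequality of a vertex group into the presentation of the
  graph product.\<close>

lemma is_product_hom:
  assumes F: "Group.group F" and F': "Group.group F'" and \<phi>: "\<phi> \<in> hom F F'"
    and T: "T \<subseteq> carrier F" "\<phi> ` T \<subseteq> T'"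
    and x: "is_product_of_at_most F (conjugates F T) r x"
  shows "is_product_of_at_most F' (conjugates F' T') r (\<phi> x)"
proof -
  interpret F: group F by (rule F)
  interpret group_hom F F' \<phi> using F F' \<phi> by (simp add: group_hom_def group_hom_axioms_def)
  obtain xs where *: "set xs \<subseteq> conjugates F T" "real (length xs) \<le> r" "x = foldr (\<otimes>\<^bsub>F\<^esub>) xs \<one>\<^bsub>F\<^esub>"
    using x unfolding is_product_of_at_most_def by metis
  have 1: "\<phi> y \<in> conjugates F' T'" if y: "y \<in> conjugates F T" for y
  proof -
    obtain d t where d: "d \<in> carrier F" "t \<in> T" "y = d \<otimes>\<^bsub>F\<^esub> t \<otimes>\<^bsub>F\<^esub> inv\<^bsub>F\<^esub> d"
      using y by (rule conjugatesE)
    then have "\<phi> y = \<phi> d \<otimes>\<^bsub>F'\<^esub> \<phi> t \<otimes>\<^bsub>F'\<^esub> inv\<^bsub>F'\<^esub> \<phi> d" "\<phi> t \<in> T'"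
      using T(1) by (simp add: subset_iff, use d(2) T(2) in blast)
    then show ?thesis using d(1) hom_closed by (simp add: conjugatesI)
  qed
  have "\<phi> (foldr (\<otimes>\<^bsub>F\<^esub>) xs \<one>\<^bsub>F\<^esub>) = foldr (\<otimes>\<^bsub>F'\<^esub>) (map \<phi> xs) \<one>\<^bsub>F'\<^esub>"
    using *(1)
  proof (induction xs)
    case (Cons a xs)
    then have "a \<in> carrier F" "foldr (\<otimes>\<^bsub>F\<^esub>) xs \<one>\<^bsub>F\<^esub> \<in> carrier F"
      using F.conjugates_subset[OF T(1)] by (auto intro!: F.foldr_mult_closed)
    then show ?case using Cons by simp
  qed auto
  then show ?thesis unfolding is_product_of_at_most_def
    using * 1 by (intro exI[of _ "map \<phi> xs"]) auto
qed

text \<open>\<open>area F T r x y\<close>: the element \<open>y\<close> is obtained from \<open>x\<close> by at most \<open>r\<close> applications of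
  relators from \<open>T\<close>.\<close>

definition area :: "('a, 'm) monoid_scheme \<Rightarrow> 'a set \<Rightarrow> real \<Rightarrow> 'a \<Rightarrow> 'a \<Rightarrow> bool" where
  "area F T r x y \<longleftrightarrow> x \<in> carrier F \<and> y \<in> carrier F \<and>
     is_product_of_at_most F (conjugates F T) r (x \<otimes>\<^bsub>F\<^esub> inv\<^bsub>F\<^esub> y)"

context group
begin

lemma area_mono: "area G T r x y \<Longrightarrow> r \<le> s \<Longrightarrow> area G T s x y"
  by (auto simp: area_def intro: is_product_mono)

lemma area_refl: "x \<in> carrier G \<Longrightarrow> 0 \<le> r \<Longrightarrow> area G T r x x"
  by (auto simp: area_def is_product_of_at_most_def intro!: exI[of _ "[]"])

lemma area_trans:
  assumes "T \<subseteq> carrier G" "area G T r x y" "area G T s y z"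
  shows "area G T (r + s) x z"
proof -
  have "x \<otimes> inv z = (x \<otimes> inv y) \<otimes> (y \<otimes> inv z)"
    using assms unfolding area_def by (simp add: m_assoc inv_mult_cancel)
  then show ?thesis
    using assms is_product_mult[OF conjugates_subset[OF assms(1)]] unfolding area_def by simp
qed

text \<open>In the quotient of the two sides the factor \<open>q\<close> cancels and
  \<open>p\<close> becomes a conjugation, which is free. Hence rewriting a subword costs the same in
  every context.\<close>

lemma area_mult:
  assumes "T \<subseteq> carrier G" "area G T r x y" "p \<in> carrier G" "q \<in> carrier G"
  shows "area G T r (p \<otimes> x \<otimes> q) (p \<otimes> y \<otimes> q)"
proof -
  have "p \<otimes> x \<otimes> q \<otimes> inv (p \<otimes> y \<otimes> q) = p \<otimes> (x \<otimes> inv y) \<otimes> inv p"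
    using assms unfolding area_def by (simp add: m_assoc inv_mult_group inv_mult_cancel)
  then show ?thesis
    using assms is_product_conj[OF assms(1)] unfolding area_def by simp
qed

lemma area_relator:
  assumes "T \<subseteq> carrier G" "x \<in> carrier G" "y \<in> carrier G" "x \<otimes> inv y \<in> T"
  shows "area G T 1 x y"
proof -
  have "x \<otimes> inv y = \<one> \<otimes> (x \<otimes> inv y) \<otimes> inv \<one>" using assms by simp
  then have "x \<otimes> inv y \<in> conjugates G T" using assms unfolding conjugates_def by blast
  then show ?thesis using assms unfolding area_def is_product_of_at_most_def
    by (auto intro!: exI[of _ "[x \<otimes> inv y]"])
qed

lemma area_one_iff: "x \<in> carrier G \<Longrightarrow> area G T r x \<one> \<longleftrightarrow> is_product_of_at_most G (conjugates G T) r x"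
  by (simp add: area_def)

section \<open>Normal closures\<close>

lemma normal_closure_normal:
  assumes "S \<subseteq> carrier G"
  shows "normal_closure G S \<lhd> G"
proof -
  \<comment> \<open>The family of normal subgroups containing \<open>S\<close> is nonempty, so its
    intersection is a subgroup.\<close>
  have c: "carrier G \<lhd> G" by (auto simp: normal_inv_iff subgroup_self)
  show ?thesis
  unfolding normal_inv_iff
  proof (intro conjI ballI)
    show "subgroup (normal_closure G S) G" unfolding normal_closure_def
      using c assms by (intro subgroups_Inter) (auto simp: normal_imp_subgroup)
    show "x \<otimes> h \<otimes> inv x \<in> normal_closure G S" if "x \<in> carrier G" "h \<in> normal_closure G S" for x h
      using that by (auto simp: normal_closure_def normal_inv_iff)
  qed
qed

lemma subset_normal_closure: "S \<subseteq> normal_closure G S"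
  by (auto simp: normal_closure_def)

lemma normal_closure_minimal: "N \<lhd> G \<Longrightarrow> S \<subseteq> N \<Longrightarrow> normal_closure G S \<subseteq> N"
  by (auto simp: normal_closure_def)

lemma is_product_imp_normal_closure:
  assumes S: "S \<subseteq> carrier G"
    and x: "is_product_of_at_most G (conjugates G (S \<union> (\<lambda>s. inv s) ` S)) r x"
  shows "x \<in> normal_closure G S"
proof -
  interpret N: normal "normal_closure G S" G by (rule normal_closure_normal[OF S])
  have 1: "conjugates G (S \<union> (\<lambda>s. inv s) ` S) \<subseteq> normal_closure G S"
    using subset_normal_closure[of S] by (auto simp: conjugates_def intro!: N.inv_op_closed2)
  have "foldr (\<otimes>) xs \<one> \<in> normal_closure G S" if "set xs \<subseteq> normal_closure G S" for xs
    using that by (induction xs) auto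
  then show ?thesis using x 1 unfolding is_product_of_at_most_def by blast
qed

end

section \<open>Normal forms in graph products\<close>

definition perm_group :: "('s \<Rightarrow> 's) monoid" where
  "perm_group = \<lparr>carrier = {f. bij f}, monoid.mult = (\<circ>), one = id\<rparr>"

lemma perm_group_simps [simp]:
  "f \<in> carrier perm_group \<longleftrightarrow> bij f" "\<one>\<^bsub>perm_group\<^esub> = id" "f \<otimes>\<^bsub>perm_group\<^esub> g = f \<circ> g"
  by (simp_all add: perm_group_def)

lemma group_perm_group: "Group.group perm_group"
proof (rule groupI)
  fix f :: "'s \<Rightarrow> 's" assume "f \<in> carrier perm_group"
  then show "\<exists>g\<in>carrier perm_group. g \<otimes>\<^bsub>perm_group\<^esub> f = \<one>\<^bsub>perm_group\<^esub>"
    by (intro bexI[of _ "inv_into UNIV f"]) (auto simp: bij_imp_bij_inv bij_is_inj)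
qed (auto simp: bij_comp comp_assoc)

locale graph_of_groups =
  fixes V :: "'v set" and E :: "'v set set" and G :: "'v \<Rightarrow> ('a, 'm) monoid_scheme"
  assumes graph: "finite_graph V E"
    and vertex_group: "i \<in> V \<Longrightarrow> Group.group (G i)"
begin

lemma edgeD: "{i, j} \<in> E \<Longrightarrow> i \<in> V \<and> j \<in> V \<and> i \<noteq> j"
proof -
  assume "{i, j} \<in> E"
  then obtain a b where "a \<in> V" "b \<in> V" "a \<noteq> b" "{i, j} = {a, b}"
    using graph unfolding finite_graph_def by blast
  then show ?thesis unfolding doubleton_eq_iff by blast
qed

lemma edge_sym: "{i, j} \<in> E \<Longrightarrow> {j, i} \<in> E"
  by (simp only: insert_commute)

text \<open>A word of syllables, up to exchanging neighbouring syllables at adjacent vertices, is recorded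
  by its projections to the sets \<open>{i, j}\<close> of non-adjacent vertices (\<open>i = j\<close> allowed).
  Syllables at adjacent vertices enter disjoint sets of projections, so there they
  commute on the nose.\<close>

definition dep :: "'v \<Rightarrow> 'v set set" where
  "dep i = {{i, j} |j. {i, j} \<notin> E}"

definition push :: "'v \<Rightarrow> 'a \<Rightarrow> ('v set \<Rightarrow> ('v \<times> 'a) list) \<Rightarrow> 'v set \<Rightarrow> ('v \<times> 'a) list" where
  "push i g x = (\<lambda>e. if e \<in> dep i then (i, g) # x e else x e)"

definition pop :: "'v \<Rightarrow> ('v set \<Rightarrow> ('v \<times> 'a) list) \<Rightarrow> 'v set \<Rightarrow> ('v \<times> 'a) list" where
  "pop i x = (\<lambda>e. if e \<in> dep i then tl (x e) else x e)"

text \<open>For a word of syllables this says that some syllable at \<open>i\<close> can be brought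
  to the front by exchanges.\<close>

definition fronted :: "'v \<Rightarrow> ('v set \<Rightarrow> ('v \<times> 'a) list) \<Rightarrow> bool" where
  "fronted i x \<longleftrightarrow> (\<forall>e\<in>dep i. x e \<noteq> [] \<and> fst (hd (x e)) = i)"

text \<open>Trivial syllables are dropped, as a normal form contains none.\<close>

definition push1 :: "'v \<Rightarrow> 'a \<Rightarrow> ('v set \<Rightarrow> ('v \<times> 'a) list) \<Rightarrow> 'v set \<Rightarrow> ('v \<times> 'a) list" where
  "push1 i g x = (if g = \<one>\<^bsub>G i\<^esub> then x else push i g x)"

text \<open>\<open>front i\<close> and \<open>rest i\<close> are the two coordinates of a normal
  form relative to \<open>i\<close>. The entry at \<open>{i}\<close> records the syllables at
  \<open>i\<close> alone, so its head is the syllable in question; without such a syllable the first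
  coordinate is the neutral element.\<close>

definition front :: "'v \<Rightarrow> ('v set \<Rightarrow> ('v \<times> 'a) list) \<Rightarrow> 'a" where
  "front i x = (if fronted i x then snd (hd (x {i})) else \<one>\<^bsub>G i\<^esub>)"

definition rest :: "'v \<Rightarrow> ('v set \<Rightarrow> ('v \<times> 'a) list) \<Rightarrow> 'v set \<Rightarrow> ('v \<times> 'a) list" where
  "rest i x = (if fronted i x then pop i x else x)"

lemma singleton_dep [simp]: "{i} \<in> dep i"
  using edgeD[of i i] by (auto simp: dep_def intro!: exI[of _ i])

text \<open>A common member would contain both \<open>i\<close> and \<open>j\<close>, hence be the
  edge \<open>{i, j}\<close>, which is excluded.\<close>

lemma dep_disjoint: "{i, j} \<in> E \<Longrightarrow> e \<in> dep i \<Longrightarrow> e \<notin> dep j"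
proof
  assume e: "{i, j} \<in> E" "e \<in> dep i" "e \<in> dep j"
  then obtain k l where "e = {i, k}" "{i, k} \<notin> E" "e = {j, l}" by (auto simp: dep_def)
  then have "{i, k} = {j, l}" "{i, k} \<notin> E" by simp_all
  then show False using edgeD[OF e(1)] e(1) by (metis doubleton_eq_iff)
qed

text \<open>The projection to \<open>{i, j}\<close> belongs to both vertices, and after the push it
  starts with a syllable at \<open>j\<close>.\<close>

lemma not_fronted_push: "{i, j} \<notin> E \<Longrightarrow> i \<noteq> j \<Longrightarrow> \<not> fronted i (push j h x)"
proof
  assume e: "{i, j} \<notin> E" "i \<noteq> j" "fronted i (push j h x)"
  have "{i, j} \<in> dep i" unfolding dep_def using e(1) by blast
  moreover have "{i, j} \<in> dep j" unfolding dep_def using e(1) insert_commute[of i j "{}"] by auto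
  ultimately show False using e unfolding fronted_def push_def by force
qed

lemma
  shows fronted_push [simp]: "fronted i (push i g x)"
    and pop_push [simp]: "pop i (push i g x) = x"
    and hd_push [simp]: "hd (push i g x {i}) = (i, g)"
  by (auto simp: fronted_def push_def pop_def)

lemma
  assumes "{i, j} \<in> E"
  shows push_push: "push i g (push j h x) = push j h (push i g x)"
    and pop_push_adj: "pop i (push j h x) = push j h (pop i x)"
    and pop_pop: "pop i (pop j x) = pop j (pop i x)"
    and fronted_push_adj: "fronted i (push j h x) = fronted i x"
    and fronted_pop_adj: "fronted i (pop j x) = fronted i x"
    and push_adj_at: "push j h x {i} = x {i}"
    and pop_adj_at: "pop j x {i} = x {i}"
  using dep_disjoint[OF assms] singleton_dep[of i]
  by (auto simp: push_def pop_def fronted_def fun_eq_iff)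

lemma
  assumes "{i, j} \<in> E"
  shows push1_push1: "push1 i g (push1 j h x) = push1 j h (push1 i g x)"
    and front_push1_adj: "front i (push1 j h x) = front i x"
    and front_rest_adj: "front i (rest j x) = front i x"
    and rest_push1_adj: "rest i (push1 j h x) = push1 j h (rest i x)"
    and rest_rest: "rest i (rest j x) = rest j (rest i x)"
  using push_push[OF assms] pop_push_adj[OF assms] pop_pop[OF assms] fronted_push_adj[OF assms]
    fronted_pop_adj[OF assms] push_adj_at[OF assms] pop_adj_at[OF assms]
    fronted_pop_adj[OF edge_sym[OF assms]] fronted_push_adj[OF edge_sym[OF assms]]
  by (simp_all add: push1_def front_def rest_def)

lemma
  assumes "\<not> fronted i x"
  shows front_push1: "front i (push1 i g x) = g"
    and rest_push1: "rest i (push1 i g x) = x"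
  using assms by (simp_all add: push1_def front_def rest_def)

definition trace :: "('v \<times> 'a) list \<Rightarrow> 'v set \<Rightarrow> ('v \<times> 'a) list" where
  "trace u = foldr (\<lambda>(i, g). push i g) u (\<lambda>_. [])"

lemma trace_simps [simp]: "trace [] = (\<lambda>_. [])" "trace ((i, g) # u) = push i g (trace u)"
  by (simp_all add: trace_def)

lemma trace_eq_empty: "trace u = (\<lambda>_. []) \<Longrightarrow> u = []"
  by (cases u) (auto simp: push_def fun_eq_iff dest: spec[of _ "{fst (hd u)}"])

text \<open>The usual reduced words of a graph product: no syllable is trivial, and none can be
  moved next to a later one at the same vertex.\<close>

fun reduced :: "('v \<times> 'a) list \<Rightarrow> bool" where
  "reduced [] \<longleftrightarrow> True"
| "reduced ((i, g) # u) \<longleftrightarrow>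
    i \<in> V \<and> g \<in> carrier (G i) \<and> g \<noteq> \<one>\<^bsub>G i\<^esub> \<and> \<not> fronted i (trace u) \<and> reduced u"

text \<open>Every syllable before the first one at \<open>i\<close> is at a vertex adjacent to
  \<open>i\<close> by \<open>not_fronted_push\<close>, and being fronted survives its removal, so
  induction reaches a syllable at \<open>i\<close>. The last two conclusions allow the rewriting to
  change the value of this syllable where it stands.\<close>

lemma reduced_fronted:
  assumes "reduced u" "fronted i (trace u)"
  obtains p h q where "u = p @ (i, h) # q" "i \<in> V" "h \<in> carrier (G i)" "h \<noteq> \<one>\<^bsub>G i\<^esub>"
    "\<forall>(j, g)\<in>set p. {i, j} \<in> E" "reduced (p @ q)" "\<not> fronted i (trace (p @ q))"
    "\<And>g. g \<in> carrier (G i) \<Longrightarrow> g \<noteq> \<one>\<^bsub>G i\<^esub> \<Longrightarrow> reduced (p @ (i, g) # q)"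
    "\<And>g. trace (p @ (i, g) # q) = push i g (trace (p @ q))"
proof -
  have "\<exists>p h q. u = p @ (i, h) # q \<and> i \<in> V \<and> h \<in> carrier (G i) \<and> h \<noteq> \<one>\<^bsub>G i\<^esub> \<and>
      (\<forall>(j, g)\<in>set p. {i, j} \<in> E) \<and> reduced (p @ q) \<and> \<not> fronted i (trace (p @ q)) \<and>
      (\<forall>g\<in>carrier (G i). g \<noteq> \<one>\<^bsub>G i\<^esub> \<longrightarrow> reduced (p @ (i, g) # q)) \<and>
      (\<forall>g. trace (p @ (i, g) # q) = push i g (trace (p @ q)))"
    using assms
  proof (induction u)
    case Nil
    then show ?case using singleton_dep[of i] unfolding fronted_def by fastforce
  next
    case (Cons a u)
    obtain j h where a: "a = (j, h)" by (cases a)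
    show ?case
    proof (cases "i = j")
      case True
      with Cons a show ?thesis by (intro exI[of _ "[]"] exI[of _ h] exI[of _ u]) auto
    next
      case False
      have ij: "{i, j} \<in> E"
        using Cons.prems(2) a False not_fronted_push[of i j h "trace u"] by auto
      note ji = edge_sym[OF ij]
      have *: "reduced u" "fronted i (trace u)" "j \<in> V" "h \<in> carrier (G j)" "h \<noteq> \<one>\<^bsub>G j\<^esub>"
        "\<not> fronted j (trace u)"
        using Cons.prems fronted_push_adj[OF ij] by (auto simp: a)
      obtain p k q where IH: "u = p @ (i, k) # q" "i \<in> V" "k \<in> carrier (G i)" "k \<noteq> \<one>\<^bsub>G i\<^esub>"
        "\<forall>(j, g)\<in>set p. {i, j} \<in> E" "reduced (p @ q)" "\<not> fronted i (trace (p @ q))"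
        "\<forall>g\<in>carrier (G i). g \<noteq> \<one>\<^bsub>G i\<^esub> \<longrightarrow> reduced (p @ (i, g) # q)"
        "\<And>g. trace (p @ (i, g) # q) = push i g (trace (p @ q))"
        using Cons.IH[OF *(1,2)] by blast
      \<comment> \<open>Since \<open>j\<close> is adjacent to \<open>i\<close>, taking out the
        syllable at \<open>i\<close> cannot expose one at \<open>j\<close>.\<close>
      have "\<not> fronted j (trace (p @ q))"
        using *(6) unfolding IH(1,9) by (simp add: fronted_push_adj[OF ji])
      then show ?thesis
        using a * IH ij ji
        by (intro exI[of _ "(j, h) # p"] exI[of _ k] exI[of _ q])
          (simp add: fronted_push_adj push_push[OF ij])
    qed
  qed
  then show ?thesis using that by blast
qed

text \<open>The normal forms. Words that differ by exchanges have equal traces, so neither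
  equivalence classes nor an ordering of the vertices is needed.\<close>

definition states :: "('v set \<Rightarrow> ('v \<times> 'a) list) set" where
  "states = trace ` {u. reduced u}"

lemma push1_states:
  assumes "x \<in> states" "i \<in> V" "g \<in> carrier (G i)" "\<not> fronted i x"
  shows "push1 i g x \<in> states"
proof -
  obtain u where u: "reduced u" "x = trace u" using assms by (auto simp: states_def)
  have "g \<noteq> \<one>\<^bsub>G i\<^esub> \<Longrightarrow> trace ((i, g) # u) \<in> states"
    using assms u unfolding states_def by (intro imageI) simp
  then show ?thesis using assms u by (simp add: push1_def)
qed

text \<open>The rest has no second syllable at \<open>i\<close> in front because the word was
  reduced. Together with \<open>front_push1\<close> and \<open>rest_push1\<close> this makes
  (\<open>front i\<close>, \<open>rest i\<close>) a faithful pair of coordinates on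
  \<open>states\<close>.\<close>

lemma states_decomp:
  assumes "x \<in> states" "i \<in> V"
  shows "rest i x \<in> states" "\<not> fronted i (rest i x)" "front i x \<in> carrier (G i)"
    and "push1 i (front i x) (rest i x) = x"
proof -
  interpret group "G i" using assms vertex_group by simp
  have "rest i x \<in> states \<and> \<not> fronted i (rest i x) \<and> front i x \<in> carrier (G i) \<and>
    push1 i (front i x) (rest i x) = x"
  proof (cases "fronted i x")
    case True
    obtain u where u: "reduced u" "x = trace u" using assms by (auto simp: states_def)
    obtain p h q where *: "u = p @ (i, h) # q" "h \<in> carrier (G i)" "h \<noteq> \<one>\<^bsub>G i\<^esub>"
      "reduced (p @ q)" "\<not> fronted i (trace (p @ q))"
      "\<And>g. trace (p @ (i, g) # q) = push i g (trace (p @ q))"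
      using reduced_fronted[OF u(1), of i] True u by metis
    have x: "x = push1 i h (trace (p @ q))"
      using u * by (simp add: push1_def)
    show ?thesis using *(2,4,5) unfolding x front_push1[OF *(5)] rest_push1[OF *(5)]
      by (auto simp: states_def)
  next
    case False
    with assms show ?thesis by (simp add: rest_def front_def push1_def)
  qed
  then show "rest i x \<in> states" "\<not> fronted i (rest i x)" "front i x \<in> carrier (G i)"
    "push1 i (front i x) (rest i x) = x" by auto
qed

text \<open>Left translation of the first coordinate. Outside \<open>states\<close> the map is the
  identity, which makes it a permutation of the whole type and hence an element of
  \<open>perm_group\<close>.\<close>

definition act :: "'v \<Rightarrow> 'a \<Rightarrow> ('v set \<Rightarrow> ('v \<times> 'a) list) \<Rightarrow> 'v set \<Rightarrow> ('v \<times> 'a) list" where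
  "act i g x = (if x \<in> states then push1 i (g \<otimes>\<^bsub>G i\<^esub> front i x) (rest i x) else x)"

lemma act_closed:
  assumes "i \<in> V" "g \<in> carrier (G i)" "x \<in> states"
  shows "act i g x \<in> states"
proof -
  interpret group "G i" using assms vertex_group by simp
  show ?thesis unfolding act_def using assms states_decomp[of x i] by (simp add: push1_states)
qed

lemma act_mult:
  assumes "i \<in> V" "g \<in> carrier (G i)" "h \<in> carrier (G i)"
  shows "act i g \<circ> act i h = act i (g \<otimes>\<^bsub>G i\<^esub> h)"
proof
  fix x
  interpret group "G i" using assms vertex_group by simp
  show "(act i g \<circ> act i h) x = act i (g \<otimes>\<^bsub>G i\<^esub> h) x"
  proof (cases "x \<in> states")
    case True
    note x = states_decomp[OF True assms(1)]
    have "act i g (act i h x) = push1 i (g \<otimes>\<^bsub>G i\<^esub> (h \<otimes>\<^bsub>G i\<^esub> front i x)) (rest i x)"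
      using act_closed[OF assms(1,3) True] True x
      by (simp add: act_def front_push1 rest_push1)
    then show ?thesis using True x assms by (simp add: act_def m_assoc)
  qed (simp add: act_def)
qed

lemma act_one:
  assumes "i \<in> V" shows "act i \<one>\<^bsub>G i\<^esub> = id"
proof
  fix x
  interpret group "G i" using assms vertex_group by simp
  show "act i \<one>\<^bsub>G i\<^esub> x = id x"
    using states_decomp[of x i] assms by (simp add: act_def)
qed

text \<open>The coordinates at adjacent vertices are read off and changed in disjoint sets of
  projections.\<close>

lemma act_commute:
  assumes e: "{i, j} \<in> E" and gh: "g \<in> carrier (G i)" "h \<in> carrier (G j)"
  shows "act i g \<circ> act j h = act j h \<circ> act i g"
proof
  fix x
  have ij: "i \<in> V" "j \<in> V" and e': "{j, i} \<in> E" using edgeD[OF e] edge_sym[OF e] by auto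
  show "(act i g \<circ> act j h) x = (act j h \<circ> act i g) x"
  proof (cases "x \<in> states")
    case True
    have "act i g x \<in> states" "act j h x \<in> states" using True act_closed ij gh by auto
    then show ?thesis using True
      by (simp add: act_def rest_push1_adj[OF e] rest_push1_adj[OF e'] front_push1_adj[OF e]
          front_push1_adj[OF e'] front_rest_adj[OF e] front_rest_adj[OF e']
          push1_push1[OF e] rest_rest[OF e])
  qed (simp add: act_def)
qed

lemma act_bij:
  assumes "i \<in> V" "g \<in> carrier (G i)"
  shows "bij (act i g)"
proof -
  interpret group "G i" using assms vertex_group by simp
  show ?thesis
    using act_mult[of i g "inv\<^bsub>G i\<^esub> g"] act_mult[of i "inv\<^bsub>G i\<^esub> g" g] act_one assms
    by (intro o_bij[of "act i (inv\<^bsub>G i\<^esub> g)"]) simp_all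
qed

section \<open>The free product and its action on normal forms\<close>

abbreviation "FP \<equiv> free_product V G"
abbreviation "syll \<equiv> free_product_incl V G"

definition edge_rels :: "('v \<times> 'a) list set set" where
  "edge_rels = {commutator FP (syll i g) (syll j h) | i j g h.
     i \<in> V \<and> j \<in> V \<and> {i, j} \<in> E \<and> g \<in> carrier (G i) \<and> h \<in> carrier (G j)}"

lemma graph_product_eq: "graph_product V E G = FP Mod normal_closure FP edge_rels"
  by (simp add: graph_product_def edge_rels_def)

lemma product_rel_cong:
  "(u, v) \<in> product_rels V G \<Longrightarrow> u \<in> lists (product_letters V G) \<Longrightarrow> v \<in> lists (product_letters V G)
    \<Longrightarrow> (u, v) \<in> word_cong (product_letters V G) (product_rels V G)"
  using word_cong.step[of u v "product_rels V G" "[]" "product_letters V G" "[]"] by simp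

lemma mem_product_letters [simp]: "(i, g) \<in> product_letters V G \<longleftrightarrow> i \<in> V \<and> g \<in> carrier (G i)"
  by (simp add: product_letters_def)

lemma one_cong:
  assumes "i \<in> V"
  shows "([(i, \<one>\<^bsub>G i\<^esub>)], []) \<in> word_cong (product_letters V G) (product_rels V G)"
proof -
  interpret group "G i" using assms vertex_group by simp
  show ?thesis using assms by (intro product_rel_cong) (auto simp: product_rels_def)
qed

lemma mult_cong:
  assumes "i \<in> V" "g \<in> carrier (G i)" "h \<in> carrier (G i)"
  shows "([(i, g), (i, h)], [(i, g \<otimes>\<^bsub>G i\<^esub> h)]) \<in> word_cong (product_letters V G) (product_rels V G)"
proof -
  interpret group "G i" using assms vertex_group by simp
  show ?thesis using assms by (intro product_rel_cong) (auto simp: product_rels_def)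
qed

lemma group_free_product: "Group.group FP"
  unfolding free_product_def
proof (rule group_word_quotient)
  fix a assume "a \<in> product_letters V G"
  then obtain i g where a: "a = (i, g)" "i \<in> V" "g \<in> carrier (G i)"
    by (auto simp: product_letters_def)
  interpret group "G i" using a vertex_group by simp
  have "([(i, inv\<^bsub>G i\<^esub> g), (i, g)], [(i, \<one>\<^bsub>G i\<^esub>)])
      \<in> word_cong (product_letters V G) (product_rels V G)"
    using mult_cong[of i "inv\<^bsub>G i\<^esub> g" g] a by simp
  then have "([(i, inv\<^bsub>G i\<^esub> g), (i, g)], []) \<in> word_cong (product_letters V G) (product_rels V G)"
    using one_cong[OF a(2)] by (rule word_cong.trans)
  then show "\<exists>v\<in>lists (product_letters V G).
      (v @ [a], []) \<in> word_cong (product_letters V G) (product_rels V G)"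
    using a by (intro bexI[of _ "[(i, inv\<^bsub>G i\<^esub> g)]"]) simp_all
qed

lemma syll_closed [simp]: "i \<in> V \<Longrightarrow> g \<in> carrier (G i) \<Longrightarrow> syll i g \<in> carrier FP"
  by (simp add: free_product_incl_def free_product_def)

lemma syll_hom: "i \<in> V \<Longrightarrow> syll i \<in> hom (G i) FP"
proof (rule homI)
  fix g h assume *: "i \<in> V" "g \<in> carrier (G i)" "h \<in> carrier (G i)"
  interpret group "G i" using * vertex_group by simp
  show "syll i (g \<otimes>\<^bsub>G i\<^esub> h) = syll i g \<otimes>\<^bsub>FP\<^esub> syll i h"
    using * mult_cong[OF *] word_cong.sym[OF mult_cong[OF *]]
    by (simp add: free_product_incl_def free_product_def mult_word_class word_class_eq_iff)
qed simp

lemma edge_rels_closed: "edge_rels \<subseteq> carrier FP"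
proof -
  interpret group FP by (rule group_free_product)
  show ?thesis by (auto simp: edge_rels_def commutator_def)
qed

lemma word_class_eq_eval_syll:
  "w \<in> lists (product_letters V G) \<Longrightarrow>
    word_class (product_letters V G) (product_rels V G) w = word_eval FP (\<lambda>(i, g). syll i g) w"
  by (simp add: word_class_eq_eval[of w] free_product_def free_product_incl_def[abs_def] split_def)

text \<open>The permutations \<open>act i g\<close> satisfy the relations of the free product and,
  by \<open>act_commute\<close>, the edge relations. So the whole normal closure lies in the kernel
  of the action. This half of the normal form theorem is what the rewriting needs.\<close>

lemma act_trivial:
  assumes w: "w \<in> lists (product_letters V G)"
    and "word_eval FP (\<lambda>(i, g). syll i g) w \<in> normal_closure FP edge_rels"
  shows "foldr (\<lambda>(i, g). act i g) w = id"
proof -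
  let ?f = "\<lambda>(i, g). act i g"
  interpret FP: group FP by (rule group_free_product)
  interpret P: group "perm_group :: (('v set \<Rightarrow> ('v \<times> 'a) list) \<Rightarrow> _) monoid" by (rule group_perm_group)
  have f: "?f \<in> product_letters V G \<rightarrow> carrier perm_group"
    by (auto simp: product_letters_def act_bij)
  have rel: "word_eval perm_group ?f u = word_eval perm_group ?f v"
    if "(u, v) \<in> product_rels V G" "u \<in> lists (product_letters V G)"
      "v \<in> lists (product_letters V G)" for u v
    using that by (auto simp: product_rels_def act_one act_mult)
  obtain \<phi> where \<phi>: "\<phi> \<in> hom (word_quotient (product_letters V G) (product_rels V G)) perm_group"
    "\<And>w. w \<in> lists (product_letters V G) \<Longrightarrow>
      \<phi> (word_class (product_letters V G) (product_rels V G) w) = word_eval perm_group ?f w"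
    using word_quotient_lift[OF P.is_monoid f rel] by blast
  interpret \<phi>: group_hom FP perm_group \<phi>
    using \<phi>(1) by unfold_locales (simp add: free_product_def)
  have syll: "\<phi> (syll i g) = act i g" if "i \<in> V" "g \<in> carrier (G i)" for i g
    using \<phi>(2)[of "[(i, g)]"] that by (simp add: free_product_incl_def)
  have "edge_rels \<subseteq> kernel FP perm_group \<phi>"
  proof
    fix r assume "r \<in> edge_rels"
    then obtain i j g h where r: "r = commutator FP (syll i g) (syll j h)" "i \<in> V" "j \<in> V"
      "{i, j} \<in> E" "g \<in> carrier (G i)" "h \<in> carrier (G j)"
      unfolding edge_rels_def by blast
    have c: "act i g \<in> carrier perm_group" "act j h \<in> carrier perm_group"
      using r act_bij by auto
    have "\<phi> r = act i g \<otimes>\<^bsub>perm_group\<^esub> act j h \<otimes>\<^bsub>perm_group\<^esub> inv\<^bsub>perm_group\<^esub> act i g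
        \<otimes>\<^bsub>perm_group\<^esub> inv\<^bsub>perm_group\<^esub> act j h"
      using r by (simp add: commutator_def syll del: perm_group_simps)
    also have "act i g \<otimes>\<^bsub>perm_group\<^esub> act j h = act j h \<otimes>\<^bsub>perm_group\<^esub> act i g"
      using act_commute r by simp
    also have "\<dots> \<otimes>\<^bsub>perm_group\<^esub> inv\<^bsub>perm_group\<^esub> act i g \<otimes>\<^bsub>perm_group\<^esub> inv\<^bsub>perm_group\<^esub> act j h
        = \<one>\<^bsub>perm_group\<^esub>"
      using c by (simp add: P.m_assoc P.inv_mult_cancel del: perm_group_simps)
    finally show "r \<in> kernel FP perm_group \<phi>"
      using \<open>r \<in> edge_rels\<close> edge_rels_closed by (auto simp: kernel_def)
  qed
  then have "normal_closure FP edge_rels \<subseteq> kernel FP perm_group \<phi>"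
    by (intro FP.normal_closure_minimal \<phi>.normal_kernel)
  moreover have "word_eval FP (\<lambda>(i, g). syll i g) w =
      word_class (product_letters V G) (product_rels V G) w"
    using word_class_eq_eval_syll[OF w] by simp
  moreover have "word_eval perm_group ?f w = foldr ?f w"
    by (induction w) auto
  ultimately show ?thesis
    using assms \<phi>(2)[OF w] by (auto simp: kernel_def)
qed

end

section \<open>Rewriting words over the vertex presentations\<close>

text \<open>The generators of every vertex group are natural numbers, so those of different vertices
  may coincide; \<open>enc\<close> serves to make disjoint copies that are natural numbers
  again.\<close>

locale presented_graph_of_groups = graph_of_groups V E G
  for V :: "'v set" and E :: "'v set set" and G :: "'v \<Rightarrow> ('a, 'm) monoid_scheme" +
  fixes gens :: "'v \<Rightarrow> nat set" and rels :: "'v \<Rightarrow> (nat \<times> bool) list set set"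
    and \<theta> :: "'v \<Rightarrow> (nat \<times> bool) list set set \<Rightarrow> 'a" and enc :: "'v \<Rightarrow> nat"
    and f :: "'v \<Rightarrow> nat \<Rightarrow> real" and F :: "nat \<Rightarrow> real"
  assumes enc: "inj_on enc V"
    and finite_gens: "i \<in> V \<Longrightarrow> finite (gens i)"
    and finite_rels: "i \<in> V \<Longrightarrow> finite (rels i)"
    and rels_closed: "i \<in> V \<Longrightarrow> rels i \<subseteq> carrier (free_group (gens i))"
    and \<theta>: "i \<in> V \<Longrightarrow> \<theta> i \<in> iso (presented_group (gens i) (rels i)) (G i)"
    and isoperimetric: "i \<in> V \<Longrightarrow> isoperimetric_function (gens i) (rels i) (f i)"
    and f_le_F: "i \<in> V \<Longrightarrow> 0 < n \<Longrightarrow> f i n \<le> F n"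
    and F_superadditive: "F m + F n \<le> F (m + n)"
    and F_nonneg: "0 \<le> F n"
begin

abbreviation "words i \<equiv> lists (free_letters (gens i))"

definition vhom :: "'v \<Rightarrow> (nat \<times> bool) list set \<Rightarrow> 'a" where
  "vhom i x = \<theta> i (normal_closure (free_group (gens i)) (rels i) #>\<^bsub>free_group (gens i)\<^esub> x)"

definition val :: "'v \<Rightarrow> (nat \<times> bool) list \<Rightarrow> 'a" where
  "val i w = vhom i (free_word (gens i) w)"

lemma vhom_hom:
  assumes "i \<in> V" shows "group_hom (free_group (gens i)) (G i) (vhom i)"
proof -
  interpret FG: group "free_group (gens i)" by (rule group_free_group)
  interpret N: normal "normal_closure (free_group (gens i)) (rels i)" "free_group (gens i)"
    using rels_closed[OF assms] by (rule FG.normal_closure_normal)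
  have "vhom i = \<theta> i \<circ> (\<lambda>x. normal_closure (free_group (gens i)) (rels i) #>\<^bsub>free_group (gens i)\<^esub> x)"
    by (simp add: vhom_def fun_eq_iff)
  also have "\<dots> \<in> hom (free_group (gens i)) (G i)"
    using \<theta>[OF assms] N.r_coset_hom_Mod
    by (intro hom_compose) (auto simp: iso_def presented_group_def)
  finally show ?thesis
    using group_free_group vertex_group[OF assms] by (simp add: group_hom_def group_hom_axioms_def)
qed

lemma val_simps [simp]:
  assumes "i \<in> V"
  shows "w \<in> words i \<Longrightarrow> val i w \<in> carrier (G i)"
    and "val i [] = \<one>\<^bsub>G i\<^esub>"
    and "v \<in> words i \<Longrightarrow> w \<in> words i \<Longrightarrow> val i (v @ w) = val i v \<otimes>\<^bsub>G i\<^esub> val i w"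
proof -
  interpret group_hom "free_group (gens i)" "G i" "vhom i" by (rule vhom_hom[OF assms])
  show "w \<in> words i \<Longrightarrow> val i w \<in> carrier (G i)" by (simp add: val_def)
  show "val i [] = \<one>\<^bsub>G i\<^esub>" by (simp add: val_def flip: one_free_group)
  show "v \<in> words i \<Longrightarrow> w \<in> words i \<Longrightarrow> val i (v @ w) = val i v \<otimes>\<^bsub>G i\<^esub> val i w"
    by (simp add: val_def free_word_append)
qed

lemma val_Cons:
  assumes "i \<in> V" "a \<in> free_letters (gens i)" "w \<in> words i"
  shows "val i (a # w) = val i [a] \<otimes>\<^bsub>G i\<^esub> val i w"
  using val_simps(3)[of i "[a]" w] assms by simp

lemma val_inv:
  assumes "i \<in> V" "y \<in> gens i"
  shows "val i [(y, \<not> b)] = inv\<^bsub>G i\<^esub> val i [(y, b)]"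
proof -
  interpret group_hom "free_group (gens i)" "G i" "vhom i" by (rule vhom_hom[OF assms(1)])
  show ?thesis using assms by (simp add: val_def flip: inv_free_letter)
qed

lemma val_surj:
  assumes "i \<in> V" "g \<in> carrier (G i)"
  obtains w where "w \<in> words i" "val i w = g"
proof -
  have "g \<in> \<theta> i ` carrier (presented_group (gens i) (rels i))"
    using \<theta>[OF assms(1)] assms(2) by (auto simp: iso_def bij_betw_def)
  then show ?thesis
    using that by (auto simp: presented_group_def carrier_FactGroup carrier_free_group val_def vhom_def)
qed

lemma vhom_rels:
  assumes "i \<in> V" "r \<in> rels i"
  shows "vhom i r = \<one>\<^bsub>G i\<^esub>"
proof -
  interpret FG: group "free_group (gens i)" by (rule group_free_group)
  let ?N = "normal_closure (free_group (gens i)) (rels i)"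
  interpret N: normal ?N "free_group (gens i)"
    using rels_closed[OF assms(1)] by (rule FG.normal_closure_normal)
  interpret Q: group "free_group (gens i) Mod ?N" by (rule N.factorgroup_is_group)
  interpret G: group "G i" using assms vertex_group by simp
  have "r \<in> ?N" using assms FG.subset_normal_closure by blast
  then have "?N #>\<^bsub>free_group (gens i)\<^esub> r = ?N"
    using N.is_subgroup by (intro FG.coset_join2) (auto intro: N.mem_carrier)
  moreover have "\<theta> i ?N = \<one>\<^bsub>G i\<^esub>"
    using hom_one[OF iso_imp_homomorphism[OF \<theta>[OF assms(1)]] _ G.is_group] Q.is_group
    by (simp add: presented_group_def)
  ultimately show ?thesis by (simp add: vhom_def)
qed

text \<open>Injectivity of \<open>\<theta> i\<close> turns triviality in \<open>G i\<close> into
  triviality in the presented group, where the isoperimetric function applies.\<close>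

lemma val_one_area:
  assumes "i \<in> V" "w \<in> words i" "val i w = \<one>\<^bsub>G i\<^esub>"
  shows "is_product_of_at_most (free_group (gens i)) (conjugates (free_group (gens i))
           (rels i \<union> (\<lambda>s. inv\<^bsub>free_group (gens i)\<^esub> s) ` rels i)) (f i (length w)) (free_word (gens i) w)"
proof -
  interpret FG: group "free_group (gens i)" by (rule group_free_group)
  let ?N = "normal_closure (free_group (gens i)) (rels i)"
  interpret N: normal ?N "free_group (gens i)"
    using rels_closed[OF assms(1)] by (rule FG.normal_closure_normal)
  interpret Q: group "free_group (gens i) Mod ?N" by (rule N.factorgroup_is_group)
  interpret G: group "G i" using assms vertex_group by simp
  have iso: "\<theta> i \<in> iso (free_group (gens i) Mod ?N) (G i)"
    using \<theta>[OF assms(1)] by (simp add: presented_group_def)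
  have one: "\<theta> i \<one>\<^bsub>free_group (gens i) Mod ?N\<^esub> = \<one>\<^bsub>G i\<^esub>"
    using hom_one[OF iso_imp_homomorphism[OF iso] Q.is_group G.is_group] .
  have "inj_on (\<theta> i) (carrier (free_group (gens i) Mod ?N))"
    using iso by (simp add: iso_def bij_betw_def)
  moreover have "\<theta> i (?N #>\<^bsub>free_group (gens i)\<^esub> free_word (gens i) w) = \<theta> i \<one>\<^bsub>free_group (gens i) Mod ?N\<^esub>"
    using assms(3) one by (simp add: val_def vhom_def)
  moreover have "?N #>\<^bsub>free_group (gens i)\<^esub> free_word (gens i) w \<in> carrier (free_group (gens i) Mod ?N)"
    using assms(2) by (simp add: carrier_FactGroup)
  ultimately have "?N #>\<^bsub>free_group (gens i)\<^esub> free_word (gens i) w = \<one>\<^bsub>free_group (gens i) Mod ?N\<^esub>"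
    using Q.one_closed by (rule inj_onD)
  then show ?thesis
    using isoperimetric[OF assms(1)] assms(2)
    unfolding isoperimetric_function_def presented_group_def by blast
qed

section \<open>The combined presentation and the cost of exchanges and deletions\<close>

definition emb :: "'v \<Rightarrow> nat \<times> bool \<Rightarrow> nat \<times> bool" where
  "emb i = (\<lambda>(y, b). (prod_encode (enc i, y), b))"

definition gen :: "nat set" where
  "gen = (\<Union>i\<in>V. (\<lambda>y. prod_encode (enc i, y)) ` gens i)"

definition flip :: "nat \<times> bool \<Rightarrow> nat \<times> bool" where
  "flip = (\<lambda>(y, b). (y, \<not> b))"

abbreviation "FG \<equiv> free_group gen"
abbreviation "W \<equiv> lists (free_letters gen)"
abbreviation "fw \<equiv> free_word gen"

text \<open>Taking commutators of all pairs of signed letters, not just of generators, makes every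
  exchange of neighbouring letters cost a single relator.\<close>

definition rel :: "(nat \<times> bool) list set set" where
  "rel = (\<Union>i\<in>V. {fw (map (emb i) w) | w. w \<in> words i \<and> free_word (gens i) w \<in> rels i}) \<union>
    {fw [emb i a, emb j c, flip (emb i a), flip (emb j c)] | i j a c.
      {i, j} \<in> E \<and> a \<in> free_letters (gens i) \<and> c \<in> free_letters (gens j)}"

abbreviation "rel1 \<equiv> rel \<union> (\<lambda>s. inv\<^bsub>FG\<^esub> s) ` rel"

lemma flip_emb: "flip (emb i a) = emb i (flip a)"
  by (simp add: flip_def emb_def split_def)

lemma val_flip: "i \<in> V \<Longrightarrow> a \<in> free_letters (gens i) \<Longrightarrow> val i [flip a] = inv\<^bsub>G i\<^esub> val i [a]"
  by (cases a) (simp add: flip_def val_inv)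

lemma flip_letters [simp]: "flip a \<in> free_letters Y \<longleftrightarrow> a \<in> free_letters Y"
  by (cases a) (simp add: flip_def)

lemma emb_letters [simp]: "i \<in> V \<Longrightarrow> a \<in> free_letters (gens i) \<Longrightarrow> emb i a \<in> free_letters gen"
  by (cases a) (auto simp: emb_def gen_def)

lemma emb_words [simp]: "i \<in> V \<Longrightarrow> w \<in> words i \<Longrightarrow> map (emb i) w \<in> W"
  by (induction w) auto

lemma lettersE:
  assumes "l \<in> free_letters gen"
  obtains i a where "i \<in> V" "a \<in> free_letters (gens i)" "l = emb i a"
proof -
  obtain y b where l: "l = (y, b)" by (cases l)
  then obtain i z where "i \<in> V" "z \<in> gens i" "y = prod_encode (enc i, z)"
    using assms by (auto simp: gen_def)
  then show ?thesis using that[of i "(z, b)"] l by (simp add: emb_def)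
qed

lemma fw_flip: "l \<in> free_letters gen \<Longrightarrow> fw [flip l] = inv\<^bsub>FG\<^esub> fw [l]"
  by (cases l) (simp add: flip_def inv_free_letter)

text \<open>Consequently \<open>fw (map (emb i) w)\<close> depends only on the free group element
  that \<open>w\<close> represents.\<close>

lemma emb_hom:
  assumes "i \<in> V"
  shows "\<exists>\<eta>\<in>hom (free_group (gens i)) FG. \<forall>w\<in>words i. \<eta> (free_word (gens i) w) = fw (map (emb i) w)"
proof -
  interpret FG: group FG by (rule group_free_group)
  let ?f = "\<lambda>a. fw [emb i a]"
  have f: "?f \<in> free_letters (gens i) \<rightarrow> carrier FG" using assms by auto
  have inv: "?f (y, b) \<otimes>\<^bsub>FG\<^esub> ?f (y, \<not> b) = \<one>\<^bsub>FG\<^esub>" if "y \<in> gens i" for y b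
    using fw_flip[of "emb i (y, b)"] that assms by (simp add: flip_emb) (simp add: flip_def)
  obtain \<eta> where \<eta>: "\<eta> \<in> hom (free_group (gens i)) FG"
    "\<forall>w\<in>words i. \<eta> (free_word (gens i) w) = word_eval FG ?f w"
    using free_group_lift[OF group_free_group f inv] by blast
  have "word_eval FG ?f w = fw (map (emb i) w)" if "w \<in> words i" for w
    using that
  proof (induction w)
    case (Cons a w)
    then show ?case using free_word_append[of "[emb i a]" gen "map (emb i) w"] assms by simp
  qed (simp add: one_free_group)
  with \<eta> show ?thesis by auto
qed

lemma rel_cases:
  assumes "x \<in> rel"
  obtains (vertex) i w where "i \<in> V" "w \<in> words i" "free_word (gens i) w \<in> rels i"
      "x = fw (map (emb i) w)"
    | (edge) i j a c where "{i, j} \<in> E" "a \<in> free_letters (gens i)" "c \<in> free_letters (gens j)"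
      "x = fw [emb i a, emb j c, flip (emb i a), flip (emb j c)]"
  using assms unfolding rel_def by blast

lemma rel_closed: "rel \<subseteq> carrier FG"
proof
  fix x assume "x \<in> rel"
  then show "x \<in> carrier FG"
  proof (cases rule: rel_cases)
    case (edge i j a c)
    then show ?thesis using edgeD[of i j] by simp
  qed simp
qed

lemma rel1_closed: "rel1 \<subseteq> carrier FG"
proof -
  interpret FG: group FG by (rule group_free_group)
  show ?thesis using rel_closed by auto
qed

lemma finite_gen: "finite gen"
  using graph finite_gens by (auto simp: gen_def finite_graph_def)

lemma finite_rel: "finite rel"
proof -
  have V: "finite V" using graph by (simp add: finite_graph_def)
  have letters: "finite (free_letters (gens i))" if "i \<in> V" for i
    using finite_gens[OF that] by (simp add: free_letters_def)
  \<comment> \<open>Infinitely many words can represent one relator, but by \<open>emb_hom\<close>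
    they all give the same element, so the set is covered by an image of
    \<open>rels i\<close>.\<close>
  have 1: "finite {fw (map (emb i) w) | w. w \<in> words i \<and> free_word (gens i) w \<in> rels i}"
    if i: "i \<in> V" for i
  proof -
    obtain \<eta> where \<eta>: "\<forall>w\<in>words i. \<eta> (free_word (gens i) w) = fw (map (emb i) w)"
      using emb_hom[OF i] by blast
    have "{fw (map (emb i) w) | w. w \<in> words i \<and> free_word (gens i) w \<in> rels i} \<subseteq> \<eta> ` rels i"
      using \<eta> by (auto intro: rev_image_eqI)
    then show ?thesis using finite_rels[OF i] by (meson finite_imageI finite_subset)
  qed
  let ?A = "SIGMA i:V. free_letters (gens i)"
  have "{fw [emb i a, emb j c, flip (emb i a), flip (emb j c)] | i j a c.
      {i, j} \<in> E \<and> a \<in> free_letters (gens i) \<and> c \<in> free_letters (gens j)} \<subseteq>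
    (\<lambda>((i, a), (j, c)). fw [emb i a, emb j c, flip (emb i a), flip (emb j c)]) ` (?A \<times> ?A)"
    (is "?C \<subseteq> ?D")
  proof
    fix x assume "x \<in> ?C"
    then obtain i j a c where *: "x = fw [emb i a, emb j c, flip (emb i a), flip (emb j c)]"
      "{i, j} \<in> E" "a \<in> free_letters (gens i)" "c \<in> free_letters (gens j)" by blast
    then have "((i, a), (j, c)) \<in> ?A \<times> ?A" using edgeD[OF *(2)] by simp
    then show "x \<in> ?D" unfolding *(1) by (rule rev_image_eqI) simp
  qed
  moreover have "finite (?A \<times> ?A)" using V letters by auto
  ultimately have "finite ?C" by (meson finite_imageI finite_subset)
  then show ?thesis unfolding rel_def using V 1 by simp
qed

lemma area_fw:
  assumes "area FG rel1 r (fw x) (fw y)" "x \<in> W" "y \<in> W" "p \<in> W" "q \<in> W"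
  shows "area FG rel1 r (fw (p @ x @ q)) (fw (p @ y @ q))"
proof -
  interpret FG: group FG by (rule group_free_group)
  show ?thesis
    using FG.area_mult[OF rel1_closed assms(1), of "fw p" "fw q"] assms
    by (simp add: free_word_append FG.m_assoc)
qed

lemma area_swap:
  assumes "{i, j} \<in> E" "a \<in> free_letters (gens i)" "c \<in> free_letters (gens j)"
  shows "area FG rel1 1 (fw [emb i a, emb j c]) (fw [emb j c, emb i a])"
proof -
  interpret FG: group FG by (rule group_free_group)
  have l: "emb i a \<in> free_letters gen" "emb j c \<in> free_letters gen" using assms edgeD[of i j] by auto
  have fw2: "fw (x # y # z) = fw [x] \<otimes>\<^bsub>FG\<^esub> fw (y # z)"
    if "x \<in> free_letters gen" "y \<in> free_letters gen" "z \<in> W" for x y z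
    using free_word_append[of "[x]" gen "y # z"] that by simp
  have cl: "fw [emb i a] \<in> carrier FG" "fw [emb j c] \<in> carrier FG" using l by auto
  have "fw [emb i a, emb j c] \<otimes>\<^bsub>FG\<^esub> inv\<^bsub>FG\<^esub> fw [emb j c, emb i a] =
      fw [emb i a, emb j c, flip (emb i a), flip (emb j c)]"
    using l cl by (simp add: fw2 FG.inv_mult_group FG.m_assoc fw_flip)
  also have "\<dots> \<in> rel1" unfolding rel_def using assms by blast
  finally show ?thesis using l by (intro FG.area_relator[OF rel1_closed]) auto
qed

lemma area_move:
  assumes "i \<in> V" "a \<in> free_letters (gens i)"
    and "\<And>l. l \<in> set z \<Longrightarrow> \<exists>j c. {i, j} \<in> E \<and> c \<in> free_letters (gens j) \<and> l = emb j c"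
  shows "z \<in> W \<and> area FG rel1 (length z) (fw (emb i a # z)) (fw (z @ [emb i a]))"
  using assms(3)
proof (induction z)
  case Nil
  interpret FG: group FG by (rule group_free_group)
  show ?case using assms by (simp add: FG.area_refl)
next
  case (Cons l z)
  interpret FG: group FG by (rule group_free_group)
  obtain j c where l: "{i, j} \<in> E" "c \<in> free_letters (gens j)" "l = emb j c"
    using Cons.prems[of l] by auto
  have lW: "l \<in> free_letters gen" "emb i a \<in> free_letters gen" using l assms edgeD[of i j] by auto
  have IH: "z \<in> W" "area FG rel1 (length z) (fw (emb i a # z)) (fw (z @ [emb i a]))"
    using Cons by auto
  have "area FG rel1 1 (fw (emb i a # l # z)) (fw (l # emb i a # z))"
    using area_fw[OF area_swap[OF l(1) assms(2) l(2)], of "[]" z] lW IH(1) l by simp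
  moreover have "area FG rel1 (length z) (fw (l # emb i a # z)) (fw (l # z @ [emb i a]))"
    using area_fw[OF IH(2), of "[l]" "[]"] lW IH(1) by simp
  ultimately show ?case using FG.area_trans[OF rel1_closed] lW IH(1) by fastforce
qed

text \<open>The factorization from \<open>val_one_area\<close> is mapped along the embedding of free
  groups, which sends the relators of the vertex into \<open>rel\<close>.\<close>

lemma area_delete:
  assumes "i \<in> V" "w \<in> words i" "val i w = \<one>\<^bsub>G i\<^esub>"
  shows "area FG rel1 (f i (length w)) (fw (map (emb i) w)) (fw [])"
proof -
  interpret FG: group FG by (rule group_free_group)
  interpret FGi: group "free_group (gens i)" by (rule group_free_group)
  obtain \<eta> where \<eta>: "\<eta> \<in> hom (free_group (gens i)) FG"
    "\<forall>w\<in>words i. \<eta> (free_word (gens i) w) = fw (map (emb i) w)"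
    using emb_hom[OF assms(1)] by blast
  interpret \<eta>: group_hom "free_group (gens i)" FG \<eta> using \<eta>(1) by unfold_locales
  let ?T = "rels i \<union> (\<lambda>s. inv\<^bsub>free_group (gens i)\<^esub> s) ` rels i"
  have *: "\<eta> r \<in> rel" if r: "r \<in> rels i" for r
  proof -
    obtain w where "w \<in> words i" "r = free_word (gens i) w"
      using r rels_closed[OF assms(1)] by (auto simp: carrier_free_group)
    then show ?thesis using \<eta>(2) r assms(1) unfolding rel_def by blast
  qed
  have T: "?T \<subseteq> carrier (free_group (gens i))" using rels_closed[OF assms(1)] by auto
  have "\<eta> ` ?T \<subseteq> rel1"
    using * rels_closed[OF assms(1)] by (auto simp: subset_iff)
  from is_product_hom[OF group_free_group group_free_group \<eta>(1) T this val_one_area[OF assms]]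
  show ?thesis using assms \<eta>(2) by (simp add: FG.area_one_iff flip: one_free_group)
qed

definition tr :: "nat \<times> bool \<Rightarrow> 'v \<times> 'a" where
  "tr = (\<lambda>(x, b). case prod_decode x of (e, y) \<Rightarrow>
     (inv_into V enc e, val (inv_into V enc e) [(y, b)]))"

lemma tr_emb [simp]: "i \<in> V \<Longrightarrow> tr (emb i a) = (i, val i [a])"
  by (cases a) (simp add: tr_def emb_def enc)

section \<open>Words of syllables and the rewriting procedure\<close>

definition sylls :: "('v \<times> (nat \<times> bool) list) set" where
  "sylls = (SIGMA i:V. words i)"

definition flat :: "('v \<times> (nat \<times> bool) list) list \<Rightarrow> (nat \<times> bool) list" where
  "flat u = concat (map (\<lambda>(i, v). map (emb i) v) u)"

definition vals :: "('v \<times> (nat \<times> bool) list) list \<Rightarrow> ('v \<times> 'a) list" where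
  "vals u = map (\<lambda>(i, v). (i, val i v)) u"

lemma mem_sylls [simp]: "(i, v) \<in> sylls \<longleftrightarrow> i \<in> V \<and> v \<in> words i"
  by (simp add: sylls_def)

lemma flat_simps [simp]:
  "flat [] = []" "flat ((i, v) # u) = map (emb i) v @ flat u" "flat (p @ q) = flat p @ flat q"
  by (simp_all add: flat_def)

lemma vals_simps [simp]:
  "vals [] = []" "vals ((i, v) # u) = (i, val i v) # vals u" "vals (p @ q) = vals p @ vals q"
  by (simp_all add: vals_def)

lemma flat_W [simp]: "u \<in> lists sylls \<Longrightarrow> flat u \<in> W"
  by (induction u) (auto simp del: split_paired_All)

text \<open>Both ways of absorbing a letter at \<open>i\<close> become one: if no syllable at
  \<open>i\<close> can be brought to the front, \<open>v\<close> is the empty word in front of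
  \<open>u\<close>, and its trivial value makes \<open>push1\<close> do nothing. Otherwise
  \<open>v\<close> is the syllable that the letter will join.\<close>

lemma split_syllable:
  assumes "u \<in> lists sylls" "reduced (vals u)" "i \<in> V"
  obtains p v q where "p \<in> lists sylls" "q \<in> lists sylls" "v \<in> words i"
    "flat u = flat p @ map (emb i) v @ flat q"
    "\<forall>(j, z)\<in>set p. {i, j} \<in> E" "reduced (vals (p @ q))"
    "\<not> fronted i (trace (vals (p @ q)))"
    "\<forall>g\<in>carrier (G i). g \<noteq> \<one>\<^bsub>G i\<^esub> \<longrightarrow> reduced (vals p @ (i, g) # vals q)"
    "\<forall>g. trace (vals p @ (i, g) # vals q) = push i g (trace (vals (p @ q)))"
    "trace (vals u) = push1 i (val i v) (trace (vals (p @ q)))"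
proof (cases "fronted i (trace (vals u))")
  case True
  obtain p' h q' where *: "vals u = p' @ (i, h) # q'" "h \<noteq> \<one>\<^bsub>G i\<^esub>"
    "\<forall>(j, g)\<in>set p'. {i, j} \<in> E" "reduced (p' @ q')" "\<not> fronted i (trace (p' @ q'))"
    "\<And>g. g \<in> carrier (G i) \<Longrightarrow> g \<noteq> \<one>\<^bsub>G i\<^esub> \<Longrightarrow> reduced (p' @ (i, g) # q')"
    "\<And>g. trace (p' @ (i, g) # q') = push i g (trace (p' @ q'))"
    using reduced_fronted[OF assms(2) True] by metis
  obtain p v q where u: "u = p @ (i, v) # q" "vals p = p'" "vals q = q'" "val i v = h"
    using *(1) by (fastforce simp: vals_def map_eq_append_conv map_eq_Cons_conv)
  have 1: "\<forall>(j, z)\<in>set p. {i, j} \<in> E" using *(3) u(2) by (force simp: vals_def)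
  have 2: "trace (vals u) = push1 i (val i v) (trace (vals (p @ q)))"
    using *(2,7) u by (simp add: push1_def)
  show ?thesis by (rule that[of p q v]) (use assms u * 1 2 in simp_all)
next
  case False
  show ?thesis by (rule that[of "[]" u "[]"]) (use assms False in \<open>simp_all add: push1_def\<close>)
qed

text \<open>The argument of \<open>F\<close> is the total length of the syllables deleted so far.\<close>

lemma rewrite_to_reduced:
  assumes "w \<in> W"
  shows "\<exists>u. u \<in> lists sylls \<and> reduced (vals u) \<and>
    trace (vals u) = foldr (\<lambda>(i, g). act i g) (map tr w) (\<lambda>_. []) \<and>
    length (flat u) \<le> length w \<and>
    area FG rel1 ((real (length w))\<^sup>2 + F (length w - length (flat u))) (fw w) (fw (flat u))"
  using assms
proof (induction w rule: list.induct)
  case Nil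
  interpret FG: group FG by (rule group_free_group)
  show ?case by (rule exI[of _ "[]"]) (simp add: FG.area_refl F_nonneg)
next
  case (Cons l w)
  interpret FG: group FG by (rule group_free_group)
  from Cons.prems have "l \<in> free_letters gen" by simp
  then obtain i a where l: "i \<in> V" "a \<in> free_letters (gens i)" "l = emb i a"
    by (rule lettersE)
  interpret Gi: group "G i" using l vertex_group by simp
  have w: "w \<in> W" "l \<in> free_letters gen" using Cons.prems by auto
  obtain u where u: "u \<in> lists sylls" "reduced (vals u)"
    "trace (vals u) = foldr (\<lambda>(i, g). act i g) (map tr w) (\<lambda>_. [])"
    "length (flat u) \<le> length w"
    "area FG rel1 ((real (length w))\<^sup>2 + F (length w - length (flat u))) (fw w) (fw (flat u))"
    using Cons.IH[OF w(1)] by (elim exE conjE)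
  obtain p v q where s: "p \<in> lists sylls" "q \<in> lists sylls" "v \<in> words i"
    "flat u = flat p @ map (emb i) v @ flat q"
    "\<forall>(j, z)\<in>set p. {i, j} \<in> E" "reduced (vals (p @ q))"
    "\<not> fronted i (trace (vals (p @ q)))"
    "\<forall>g\<in>carrier (G i). g \<noteq> \<one>\<^bsub>G i\<^esub> \<longrightarrow> reduced (vals p @ (i, g) # vals q)"
    "\<forall>g. trace (vals p @ (i, g) # vals q) = push i g (trace (vals (p @ q)))"
    "trace (vals u) = push1 i (val i v) (trace (vals (p @ q)))"
    using u(1,2) l(1) by (rule split_syllable)
  let ?n = "length w" and ?av = "map (emb i) (a # v)"
  have st: "trace (vals u) \<in> states" using u(2) by (auto simp: states_def)
  \<comment> \<open>The invariant persists: the letter multiplies the front coordinate at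
    \<open>i\<close>, which is the value of \<open>v\<close> although \<open>v\<close> may stand
    behind \<open>p\<close>.\<close>
  have "foldr (\<lambda>(i, g). act i g) (map tr (l # w)) (\<lambda>_. []) = act i (val i [a]) (trace (vals u))"
    using l u(3) by simp
  also have "\<dots> = push1 i (val i (a # v)) (trace (vals (p @ q)))"
    using st l s(3) unfolding act_def s(10) front_push1[OF s(7)] rest_push1[OF s(7)]
    by (simp add: val_Cons[OF l(1,2) s(3)])
  finally have act: "foldr (\<lambda>(i, g). act i g) (map tr (l # w)) (\<lambda>_. []) =
    push1 i (val i (a # v)) (trace (vals (p @ q)))" .
  have W: "flat p \<in> W" "flat q \<in> W" "map (emb i) v \<in> W" "?av \<in> W" "flat u \<in> W"
    using s(1-3) u(1) l by auto
  have "\<exists>j c. {i, j} \<in> E \<and> c \<in> free_letters (gens j) \<and> k = emb j c" if k: "k \<in> set (flat p)" for k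
  proof -
    obtain j z c where "(j, z) \<in> set p" "c \<in> set z" "k = emb j c"
      using k by (auto simp: flat_def simp del: split_paired_Ex)
    moreover have "(j, z) \<in> sylls" using s(1) \<open>(j, z) \<in> set p\<close> in_lists_conv_set by metis
    then have "c \<in> free_letters (gens j)" using \<open>c \<in> set z\<close> in_lists_conv_set[of z] by simp
    ultimately show ?thesis using s(5) by blast
  qed
  from area_move[OF l(1,2) this]
  have "area FG rel1 (length (flat p)) (fw (emb i a # flat p)) (fw (flat p @ [emb i a]))" by blast
  from area_fw[OF this, of "[]" "map (emb i) v @ flat q"]
  have "area FG rel1 (length (flat p)) (fw (l # flat u)) (fw (flat p @ ?av @ flat q))"
    using W w(2) unfolding s(4) l(3) by simp
  moreover have "area FG rel1 ((real ?n)\<^sup>2 + F (?n - length (flat u))) (fw (l # w)) (fw (l # flat u))"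
    using area_fw[OF u(5), of "[l]" "[]"] w W by simp
  ultimately have "area FG rel1 ((real ?n)\<^sup>2 + F (?n - length (flat u)) + length (flat p))
      (fw (l # w)) (fw (flat p @ ?av @ flat q))"
    using FG.area_trans[OF rel1_closed] by blast
  \<comment> \<open>The letter passes only letters of \<open>flat p\<close>, a part of
    \<open>flat u\<close>, hence at most \<open>?n\<close> of them; and n^2 + n \<le> (n +
    1)^2.\<close>
  moreover have "(real ?n)\<^sup>2 + length (flat p) \<le> (real (length (l # w)))\<^sup>2"
    using u(4) unfolding s(4) by (simp add: power2_eq_square algebra_simps)
  ultimately have main: "area FG rel1 ((real (length (l # w)))\<^sup>2 + F (?n - length (flat u)))
      (fw (l # w)) (fw (flat p @ ?av @ flat q))"
    by (elim FG.area_mono) simp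
  show ?case
  proof (cases "val i (a # v) = \<one>\<^bsub>G i\<^esub>")
    case False
    let ?u = "p @ (i, a # v) # q"
    have "?u \<in> lists sylls" using s(1-3) l by simp
    moreover have "reduced (vals ?u)" using s(8) False s(3) l by simp
    moreover have "trace (vals ?u) = foldr (\<lambda>(i, g). act i g) (map tr (l # w)) (\<lambda>_. [])"
      unfolding act using s(9) False by (simp add: push1_def)
    moreover have "length (flat ?u) \<le> length (l # w)" using u(4) unfolding s(4) by simp
    \<comment> \<open>The new letter is kept, so it lengthens both words and the deleted length
      stays the same.\<close>
    moreover have "length (l # w) - length (flat ?u) = ?n - length (flat u)"
      unfolding s(4) by simp
    then have "area FG rel1 ((real (length (l # w)))\<^sup>2 + F (length (l # w) - length (flat ?u)))
        (fw (l # w)) (fw (flat ?u))"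
      using main by (simp only: flat_simps append_assoc)
    ultimately show ?thesis by blast
  next
    case True
    have "area FG rel1 (f i (length (a # v))) (fw ?av) (fw [])"
      using area_delete[OF l(1) _ True] l(2) s(3) by simp
    from area_fw[OF this, of "flat p" "flat q"]
    have "area FG rel1 (f i (length (a # v))) (fw (flat p @ ?av @ flat q)) (fw (flat (p @ q)))"
      using W by simp
    with main have "area FG rel1 ((real (length (l # w)))\<^sup>2 + F (?n - length (flat u)) + f i (length (a # v)))
      (fw (l # w)) (fw (flat (p @ q)))"
      using FG.area_trans[OF rel1_closed] by blast
    moreover have "F (?n - length (flat u)) + f i (length (a # v)) \<le> F (length (l # w) - length (flat (p @ q)))"
    proof -
      \<comment> \<open>The deleted length grows by exactly the length of the deleted syllable. That
        syllable contains \<open>a\<close>, so its length is positive and \<open>f_le_F\<close>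
        applies.\<close>
      have "(?n - length (flat u)) + length (a # v) = length (l # w) - length (flat (p @ q))"
        using u(4) unfolding s(4) by simp
      then show ?thesis
        using F_superadditive[of "?n - length (flat u)" "length (a # v)"] f_le_F[OF l(1), of "length (a # v)"]
        by simp
    qed
    ultimately have "area FG rel1 ((real (length (l # w)))\<^sup>2 + F (length (l # w) - length (flat (p @ q))))
      (fw (l # w)) (fw (flat (p @ q)))"
      by (elim FG.area_mono) simp
    moreover have "length (flat (p @ q)) \<le> length (l # w)" using u(4) unfolding s(4) by simp
    moreover have "p @ q \<in> lists sylls" using s(1,2) by simp
    moreover have "trace (vals (p @ q)) = foldr (\<lambda>(i, g). act i g) (map tr (l # w)) (\<lambda>_. [])"
      unfolding act using True by (simp add: push1_def)
    ultimately show ?thesis using s(6) by blast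
  qed
qed

end

section \<open>The evaluation map and its kernel\<close>

context presented_graph_of_groups begin

abbreviation "GP \<equiv> graph_product V E G"
abbreviation "NC \<equiv> normal_closure FP edge_rels"

definition ev :: "nat \<times> bool \<Rightarrow> ('v \<times> 'a) list set" where
  "ev l = (case tr l of (i, g) \<Rightarrow> syll i g)"

lemma ev_emb: "i \<in> V \<Longrightarrow> ev (emb i a) = syll i (val i [a])"
  by (simp add: ev_def)

lemma ev_closed: "ev \<in> free_letters gen \<rightarrow> carrier FP"
proof
  fix l assume "l \<in> free_letters gen"
  then obtain i a where "i \<in> V" "a \<in> free_letters (gens i)" "l = emb i a" by (rule lettersE)
  then show "ev l \<in> carrier FP" by (simp add: ev_emb)
qed

lemma tr_closed: "w \<in> W \<Longrightarrow> map tr w \<in> lists (product_letters V G)"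
proof (induction w rule: list.induct)
  case (Cons l w)
  then have "l \<in> free_letters gen" by simp
  then obtain i a where "i \<in> V" "a \<in> free_letters (gens i)" "l = emb i a" by (rule lettersE)
  with Cons show ?case by simp
qed simp

lemma word_eval_ev: "word_eval FP ev w = word_eval FP (\<lambda>(i, g). syll i g) (map tr w)"
  by (induction w) (simp_all add: ev_def)

lemma word_eval_emb:
  assumes "i \<in> V" "w \<in> words i"
  shows "word_eval FP ev (map (emb i) w) = syll i (val i w)"
proof -
  interpret FP: group FP by (rule group_free_product)
  interpret Gi: group "G i" using assms vertex_group by simp
  interpret group_hom "G i" FP "syll i" by unfold_locales (rule syll_hom[OF assms(1)])
  show ?thesis using assms(2)
  proof (induction w rule: list.induct)
    case Nil
    then show ?case using assms by simp
  next
    case (Cons a w)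
    then show ?case using assms(1) by (simp add: val_Cons[of i a w] ev_emb)
  qed
qed

text \<open>The target is the free product, so that triviality in the graph product takes the form
  of membership in \<open>NC\<close> that \<open>act_trivial\<close> asks for.\<close>

lemma eval_hom:
  obtains \<psi> where "\<psi> \<in> hom FG FP" "\<forall>w\<in>W. \<psi> (fw w) = word_eval FP ev w"
proof -
  interpret FP: group FP by (rule group_free_product)
  have "ev (y, b) \<otimes>\<^bsub>FP\<^esub> ev (y, \<not> b) = \<one>\<^bsub>FP\<^esub>" if "y \<in> gen" for y b
  proof -
    have "(y, b) \<in> free_letters gen" using \<open>y \<in> gen\<close> by simp
    then obtain i a where l: "i \<in> V" "a \<in> free_letters (gens i)" "(y, b) = emb i a"
      by (rule lettersE)
    interpret Gi: group "G i" using l vertex_group by simp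
    interpret group_hom "G i" FP "syll i" by unfold_locales (rule syll_hom[OF l(1)])
    have "(y, \<not> b) = flip (y, b)" by (simp add: flip_def)
    also have "\<dots> = emb i (flip a)" by (simp only: l(3) flip_emb)
    finally show ?thesis using l by (simp add: ev_emb val_flip)
  qed
  with free_group_lift[OF group_free_product ev_closed] that show ?thesis by blast
qed

lemma eval_rel:
  assumes \<psi>: "\<psi> \<in> hom FG FP" "\<forall>w\<in>W. \<psi> (fw w) = word_eval FP ev w" and "r \<in> rel"
  shows "\<psi> r \<in> NC"
proof -
  interpret FP: group FP by (rule group_free_product)
  interpret NC: normal NC FP using edge_rels_closed by (rule FP.normal_closure_normal)
  show ?thesis using assms(3)
  proof (cases rule: rel_cases)
    case (vertex i w)
    interpret Gi: group "G i" using vertex vertex_group by simp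
    interpret group_hom "G i" FP "syll i" by unfold_locales (rule syll_hom[OF vertex(1)])
    have "val i w = \<one>\<^bsub>G i\<^esub>" using vhom_rels vertex by (simp add: val_def)
    then have "\<psi> r = \<one>\<^bsub>FP\<^esub>" using vertex \<psi>(2) by (simp add: word_eval_emb)
    then show ?thesis by simp
  next
    case (edge i j a c)
    have ij: "i \<in> V" "j \<in> V" using edge edgeD[of i j] by auto
    interpret Gi: group "G i" using ij vertex_group by simp
    interpret Gj: group "G j" using ij vertex_group by simp
    interpret i: group_hom "G i" FP "syll i" by unfold_locales (rule syll_hom[OF ij(1)])
    interpret j: group_hom "G j" FP "syll j" by unfold_locales (rule syll_hom[OF ij(2)])
    have "ev (flip (emb i a)) = inv\<^bsub>FP\<^esub> syll i (val i [a])"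
      using edge ij by (simp add: flip_emb ev_emb val_flip)
    moreover have "ev (flip (emb j c)) = inv\<^bsub>FP\<^esub> syll j (val j [c])"
      using edge ij by (simp add: flip_emb ev_emb val_flip)
    ultimately have "\<psi> r = commutator FP (syll i (val i [a])) (syll j (val j [c]))"
      using edge ij \<psi>(2) by (simp add: ev_emb commutator_def FP.m_assoc)
    moreover have "val i [a] \<in> carrier (G i)" "val j [c] \<in> carrier (G j)" using edge ij by simp_all
    then have "commutator FP (syll i (val i [a])) (syll j (val j [c])) \<in> edge_rels"
      unfolding edge_rels_def using edge(1) ij by blast
    ultimately show ?thesis using FP.subset_normal_closure by auto
  qed
qed

lemma eval_surj:
  assumes "w \<in> lists (product_letters V G)"
  shows "\<exists>w'\<in>W. word_eval FP ev w' = word_eval FP (\<lambda>(i, g). syll i g) w"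
  using assms
proof (induction w rule: list.induct)
  case Nil
  show ?case by (intro bexI[of _ "[]"]) simp_all
next
  case (Cons l w)
  interpret FP: group FP by (rule group_free_product)
  obtain i g where l: "l = (i, g)" "i \<in> V" "g \<in> carrier (G i)"
    using Cons.prems by (cases l) auto
  obtain v where v: "v \<in> words i" "val i v = g" using l(2,3) by (rule val_surj)
  obtain w' where w': "w' \<in> W" "word_eval FP ev w' = word_eval FP (\<lambda>(i, g). syll i g) w"
    using Cons by auto
  have "map (emb i) v \<in> W" using v l by simp
  then have "word_eval FP ev (map (emb i) v @ w') = syll i g \<otimes>\<^bsub>FP\<^esub> word_eval FP ev w'"
    using FP.word_eval_append[OF ev_closed _ w'(1)] word_eval_emb[OF l(2) v(1)] v(2) by simp
  then show ?case using w' l \<open>map (emb i) v \<in> W\<close>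
    by (intro bexI[of _ "map (emb i) v @ w'"]) simp_all
qed

lemma trivial_word_area:
  assumes "w \<in> W" "word_eval FP ev w \<in> NC"
  shows "is_product_of_at_most FG (conjugates FG rel1) ((real (length w))\<^sup>2 + F (length w)) (fw w)"
proof -
  interpret FG: group FG by (rule group_free_group)
  obtain u where u: "trace (vals u) = foldr (\<lambda>(i, g). act i g) (map tr w) (\<lambda>_. [])"
    "area FG rel1 ((real (length w))\<^sup>2 + F (length w - length (flat u))) (fw w) (fw (flat u))"
    using rewrite_to_reduced[OF assms(1)] by (elim exE conjE)
  have "foldr (\<lambda>(i, g). act i g) (map tr w) = id"
    using act_trivial[OF tr_closed[OF assms(1)]] assms(2) by (simp only: word_eval_ev)
  \<comment> \<open>The trace of the remaining syllables is the image of the empty normal form under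
    the identity. With \<open>u\<close> empty, all of \<open>w\<close> counts as deleted or
    cancelled length in the bound.\<close>
  then have "trace (vals u) = (\<lambda>_. [])" using u(1) by simp
  then have "u = []" using trace_eq_empty by (fastforce simp: vals_def)
  then show ?thesis using u(2) assms(1) by (simp add: FG.area_one_iff flip: one_free_group)
qed

lemma presentation:
  "finite_presentation gen rel GP"
  "isoperimetric_function gen rel (\<lambda>n. (real n)\<^sup>2 + F n)"
proof -
  interpret FP: group FP by (rule group_free_product)
  interpret FG: group FG by (rule group_free_group)
  interpret NC: normal NC FP using edge_rels_closed by (rule FP.normal_closure_normal)
  interpret GP: group "FP Mod NC" by (rule NC.factorgroup_is_group)
  obtain \<psi> where \<psi>: "\<psi> \<in> hom FG FP" "\<forall>w\<in>W. \<psi> (fw w) = word_eval FP ev w"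
    by (rule eval_hom)
  define \<Psi> where "\<Psi> = (\<lambda>x. NC #>\<^bsub>FP\<^esub> x) \<circ> \<psi>"
  have "\<Psi> \<in> hom FG (FP Mod NC)"
    unfolding \<Psi>_def using \<psi>(1) NC.r_coset_hom_Mod by (rule hom_compose)
  then interpret \<Psi>: group_hom FG "FP Mod NC" \<Psi> by unfold_locales
  have \<psi>_closed: "\<psi> x \<in> carrier FP" if "x \<in> carrier FG" for x
    using that \<psi>(1) by (auto simp: hom_def)
  have \<Psi>_one: "\<Psi> x = \<one>\<^bsub>FP Mod NC\<^esub> \<longleftrightarrow> \<psi> x \<in> NC" if x: "x \<in> carrier FG" for x
    using FP.coset_join1[OF _ \<psi>_closed[OF x] NC.is_subgroup]
      FP.coset_join2[OF \<psi>_closed[OF x] NC.is_subgroup]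
    by (auto simp: \<Psi>_def)
  \<comment> \<open>This serves twice: as the isoperimetric inequality, and, forgetting the number
    of factors, as the proof that kernel elements lie in the normal closure of
    \<open>rel\<close>.\<close>
  have area: "is_product_of_at_most FG (conjugates FG rel1) ((real (length w))\<^sup>2 + F (length w)) (fw w)"
    if "w \<in> W" "fw w \<in> kernel FG (FP Mod NC) \<Psi>" for w
    using that trivial_word_area[of w] \<Psi>_one[of "fw w"] \<psi>(2) by (auto simp: kernel_def)
  have kernel: "kernel FG (FP Mod NC) \<Psi> = normal_closure FG rel"
  proof
    show "normal_closure FG rel \<subseteq> kernel FG (FP Mod NC) \<Psi>"
    proof (rule FG.normal_closure_minimal[OF \<Psi>.normal_kernel], rule subsetI)
      fix r assume "r \<in> rel"
      then show "r \<in> kernel FG (FP Mod NC) \<Psi>"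
        using eval_rel[OF \<psi>] \<Psi>_one[of r] rel_closed by (auto simp: kernel_def)
    qed
    show "kernel FG (FP Mod NC) \<Psi> \<subseteq> normal_closure FG rel"
    proof
      fix x assume x: "x \<in> kernel FG (FP Mod NC) \<Psi>"
      then obtain w where "w \<in> W" "x = fw w" by (auto simp: kernel_def carrier_free_group)
      with area x show "x \<in> normal_closure FG rel"
        using FG.is_product_imp_normal_closure[OF rel_closed] by blast
    qed
  qed
  have "\<Psi> ` carrier FG = carrier (FP Mod NC)"
  proof
    show "carrier (FP Mod NC) \<subseteq> \<Psi> ` carrier FG"
    proof
      fix X assume "X \<in> carrier (FP Mod NC)"
      then obtain w where w: "w \<in> lists (product_letters V G)"
        "X = NC #>\<^bsub>FP\<^esub> word_class (product_letters V G) (product_rels V G) w"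
        by (auto simp: carrier_FactGroup free_product_def carrier_word_quotient)
      obtain w' where w': "w' \<in> W" "word_eval FP ev w' = word_eval FP (\<lambda>(i, g). syll i g) w"
        using eval_surj[OF w(1)] by blast
      have "X = \<Psi> (fw w')"
        using w w' \<psi>(2) word_class_eq_eval_syll by (simp add: \<Psi>_def)
      then show "X \<in> \<Psi> ` carrier FG" using w'(1) by simp
    qed
  qed auto
  from \<Psi>.FactGroup_iso[OF this] have "presented_group gen rel \<cong> GP"
    by (simp add: presented_group_def kernel graph_product_eq)
  then show "finite_presentation gen rel GP"
    using finite_gen finite_rel rel_closed by (simp add: finite_presentation_def)
  interpret N: normal "normal_closure FG rel" FG using rel_closed by (rule FG.normal_closure_normal)
  have "is_product_of_at_most FG (conjugates FG rel1) ((real (length w))\<^sup>2 + F (length w)) (fw w)"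
    if "w \<in> W" "normal_closure FG rel #>\<^bsub>FG\<^esub> fw w = \<one>\<^bsub>presented_group gen rel\<^esub>" for w
    using that FG.coset_join1[OF _ _ N.is_subgroup, of "fw w"] area[of w] kernel
    by (simp add: presented_group_def)
  then show "isoperimetric_function gen rel (\<lambda>n. (real n)\<^sup>2 + F n)"
    unfolding isoperimetric_function_def using F_nonneg by simp
qed

end

section \<open>Polynomial and exponential bounds\<close>

lemma isoperimetric_function_mono:
  assumes "isoperimetric_function Y S f" "\<And>n. f n \<le> g n"
  shows "isoperimetric_function Y S g"
  unfolding isoperimetric_function_def
proof (intro conjI allI ballI impI)
  show "0 \<le> g n" for n
    using assms(1) assms(2)[of n] order_trans unfolding isoperimetric_function_def by blast
qed (use assms in \<open>auto simp: isoperimetric_function_def intro: is_product_mono\<close>)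

lemma graph_product_isoperimetric:
  assumes "finite_graph V E" "\<And>i. i \<in> V \<Longrightarrow> Group.group (G i)"
    and f: "\<And>i. i \<in> V \<Longrightarrow> has_isoperimetric_function (G i) (f i)"
    and F: "\<And>i n. i \<in> V \<Longrightarrow> 0 < n \<Longrightarrow> f i n \<le> F n" "\<And>m n. F m + F n \<le> F (m + n)" "\<And>n. 0 \<le> F n"
    and g: "\<And>n. (real n)\<^sup>2 + F n \<le> g n"
  shows "has_isoperimetric_function (graph_product V E G) g"
proof -
  \<comment> \<open>Bundling the data lets one use of choice select, for each vertex, a presentation
    together with its isomorphism.\<close>
  define P where "P i Y S \<theta> \<longleftrightarrow> finite Y \<and> finite S \<and> S \<subseteq> carrier (free_group Y) \<and>
      \<theta> \<in> iso (presented_group Y S) (G i) \<and> isoperimetric_function Y S (f i)"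
    for i \<theta> and Y :: "nat set" and S
  have "\<exists>Y S \<theta>. P i Y S \<theta>" if i: "i \<in> V" for i
  proof -
    obtain Y :: "nat set" and S where YS: "finite_presentation Y S (G i)" "isoperimetric_function Y S (f i)"
      using f[OF i] unfolding has_isoperimetric_function_def by (elim exE conjE)
    then obtain \<theta> where "\<theta> \<in> iso (presented_group Y S) (G i)"
      unfolding finite_presentation_def is_iso_def by (elim conjE) (auto simp only: ex_in_conv[symmetric])
    with YS have "P i Y S \<theta>" by (simp add: P_def finite_presentation_def)
    then show ?thesis by (intro exI)
  qed
  then obtain gens rels \<theta> where P: "\<And>i. i \<in> V \<Longrightarrow> P i (gens i) (rels i) (\<theta> i)"
    by metis
  have "finite V" using assms(1) by (simp add: finite_graph_def)
  then obtain enc :: "'a \<Rightarrow> nat" where enc: "inj_on enc V"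
    using finite_imp_inj_to_nat_seg by blast
  interpret presented_graph_of_groups V E G gens rels \<theta> enc f F
  proof (intro presented_graph_of_groups.intro graph_of_groups.intro presented_graph_of_groups_axioms.intro)
    fix i assume i: "i \<in> V"
    show "finite (gens i)" "finite (rels i)" "rels i \<subseteq> carrier (free_group (gens i))"
      "\<theta> i \<in> iso (presented_group (gens i) (rels i)) (G i)"
      "isoperimetric_function (gens i) (rels i) (f i)"
      using P[OF i] by (simp_all add: P_def)
  qed (use assms(1,2) enc F in simp_all)
  have "isoperimetric_function gen rel g"
    using presentation(2) g by (rule isoperimetric_function_mono)
  then show ?thesis
    using presentation(1) unfolding has_isoperimetric_function_def by (intro exI conjI)
qed

text \<open>One factor of each power is split off, and the remaining base is enlarged to
  \<open>x + y\<close>.\<close>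

lemma power_superadditive:
  fixes x y :: real
  assumes "0 \<le> x" "0 \<le> y" "0 < k"
  shows "x ^ k + y ^ k \<le> (x + y) ^ k"
proof -
  obtain l where k: "k = Suc l" using assms gr0_implies_Suc by blast
  have "x ^ k + y ^ k = x * x ^ l + y * y ^ l" by (simp add: k)
  also have "\<dots> \<le> x * (x + y) ^ l + y * (x + y) ^ l"
    using assms by (intro add_mono mult_left_mono power_mono) auto
  also have "\<dots> = (x + y) ^ k" by (simp add: k algebra_simps)
  finally show ?thesis .
qed

lemma poly_le_power:
  fixes p :: "real poly"
  assumes "1 \<le> x"
  shows "poly p x \<le> (\<Sum>i\<le>degree p. \<bar>coeff p i\<bar>) * x ^ degree p"
proof -
  have "coeff p i * x ^ i \<le> \<bar>coeff p i\<bar> * x ^ degree p" if "i \<le> degree p" for i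
    using that assms by (intro mult_mono power_increasing) auto
  then show ?thesis
    unfolding poly_altdef sum_distrib_right by (intro sum_mono) auto
qed

lemma graph_product_polynomial:
  assumes graph: "finite_graph V E" and groups: "\<And>i. i \<in> V \<Longrightarrow> Group.group (G i)" and k: "1 < k"
    and poly: "\<forall>i\<in>V. has_polynomial_isoperimetric_function (G i) k"
  shows "has_polynomial_isoperimetric_function (graph_product V E G) k"
proof -
  obtain p :: "'a \<Rightarrow> real poly" where p: "\<And>i. i \<in> V \<Longrightarrow> degree (p i) = k"
    "\<And>i. i \<in> V \<Longrightarrow> has_isoperimetric_function (G i) (\<lambda>n. poly (p i) (real n))"
    using poly unfolding has_polynomial_isoperimetric_function_def by metis
  define c where "c i = (\<Sum>l\<le>degree (p i). \<bar>coeff (p i) l\<bar>)" for i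
  define C where "C = sum c V"
  have V: "finite V" using graph by (simp add: finite_graph_def)
  have c: "0 \<le> c i" for i by (simp add: c_def sum_nonneg)
  then have C: "0 \<le> C" by (simp add: C_def sum_nonneg)
  \<comment> \<open>The extra 1 pays for n^2 \<le> n^k, and it keeps the leading coefficient nonzero
    when \<open>C\<close> is 0, as for an empty graph.\<close>
  have "has_isoperimetric_function (graph_product V E G) (\<lambda>n. poly (monom (C + 1) k) (real n))"
  proof (rule graph_product_isoperimetric[OF graph groups p(2), where F = "\<lambda>n. C * real n ^ k"])
    fix i n assume i: "i \<in> V" and n: "0 < (n :: nat)"
    have "poly (p i) (real n) \<le> c i * real n ^ k"
      using poly_le_power[of "real n" "p i"] n p(1)[OF i] by (simp add: c_def)
    also have "\<dots> \<le> C * real n ^ k"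
      unfolding C_def using V i c by (intro mult_right_mono member_le_sum) auto
    finally show "poly (p i) (real n) \<le> C * real n ^ k" .
  next
    fix m n :: nat
    show "C * real m ^ k + C * real n ^ k \<le> C * real (m + n) ^ k"
      using power_superadditive[of "real m" "real n" k] C k
      by (simp flip: distrib_left) (intro mult_left_mono; simp)
  next
    fix n :: nat
    have "(real n)\<^sup>2 \<le> real n ^ k"
      using k by (cases "n = 0") (auto intro: power_increasing)
    then show "(real n)\<^sup>2 + C * real n ^ k \<le> poly (monom (C + 1) k) (real n)"
      by (simp add: poly_monom algebra_simps)
  qed (use C in auto)
  moreover have "degree (monom (C + 1) k) = k" using C by (intro degree_monom_eq) simp
  ultimately show ?thesis unfolding has_polynomial_isoperimetric_function_def by blast
qed

lemma graph_product_exponential: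
  assumes graph: "finite_graph V E" and groups: "\<And>i. i \<in> V \<Longrightarrow> Group.group (G i)"
    and exp: "\<forall>i\<in>V. has_exponential_isoperimetric_function (G i)"
  shows "has_exponential_isoperimetric_function (graph_product V E G)"
proof -
  obtain c b where cb: "\<And>i. i \<in> V \<Longrightarrow> 0 < c i" "\<And>i. i \<in> V \<Longrightarrow> 1 < b i"
    "\<And>i. i \<in> V \<Longrightarrow> has_isoperimetric_function (G i) (\<lambda>n. c i * b i ^ n)"
    using exp unfolding has_exponential_isoperimetric_function_def by metis
  \<comment> \<open>Sums serve as upper bounds for all vertices at once; the added 1 gives
    \<open>B\<close> at least 1 even for an empty graph.\<close>
  define C B where "C = sum c V" and "B = 1 + sum b V"
  have V: "finite V" using graph by (simp add: finite_graph_def)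
  have C: "0 \<le> C" using cb(1) by (simp add: C_def sum_nonneg less_imp_le)
  have b: "0 \<le> b i" if "i \<in> V" for i using cb(2)[OF that] by simp
  have B: "1 \<le> B" using b by (simp add: B_def sum_nonneg)
  \<comment> \<open>The base \<open>4 * B\<close> absorbs both summands: n^2 \<le> (2^n)^2 = 4^n,
    and n * B^n \<le> 4^n * B^n.\<close>
  have "has_isoperimetric_function (graph_product V E G) (\<lambda>n. (C + 1) * (4 * B) ^ n)"
  \<comment> \<open>C * B^n itself is not superadditive if C > 0, as the case m = 0 shows; the
    factor n repairs this and costs nothing at n \<ge> 1.\<close>
  proof (rule graph_product_isoperimetric[OF graph groups cb(3), where F = "\<lambda>n. C * (real n * B ^ n)"])
    fix i n assume i: "i \<in> V" and n: "0 < (n :: nat)"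
    have cC: "c i \<le> C" unfolding C_def using V i cb(1) by (intro member_le_sum) (auto simp: less_imp_le)
    have "b i \<le> sum b V" using V i b by (intro member_le_sum) auto
    then have "b i ^ n \<le> B ^ n" using b[OF i] by (intro power_mono) (auto simp: B_def)
    moreover have "1 * B ^ n \<le> real n * B ^ n"
      using n B by (intro mult_right_mono) auto
    ultimately have "b i ^ n \<le> real n * B ^ n" by simp
    then show "c i * b i ^ n \<le> C * (real n * B ^ n)"
      using cC b[OF i] C by (intro mult_mono) auto
  next
    fix m n :: nat
    have "real m * B ^ m + real n * B ^ n \<le> real m * B ^ (m + n) + real n * B ^ (m + n)"
      using B by (intro add_mono mult_left_mono power_increasing) auto
    also have "\<dots> = real (m + n) * B ^ (m + n)" by (simp add: algebra_simps)
    finally show "C * (real m * B ^ m) + C * (real n * B ^ n) \<le> C * (real (m + n) * B ^ (m + n))"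
      using C by (metis distrib_left mult_left_mono)
  next
    fix n :: nat
    have n: "real n \<le> 2 ^ n" by (metis less_imp_le of_nat_less_two_power)
    have "(real n)\<^sup>2 \<le> (2 ^ n)\<^sup>2" using n by (intro power_mono) auto
    also have "\<dots> = (4 :: real) ^ n" by (simp add: power2_eq_square flip: power_mult_distrib)
    also have "\<dots> \<le> (4 * B) ^ n" using B by (intro power_mono) auto
    finally have 1: "(real n)\<^sup>2 \<le> (4 * B) ^ n" .
    have "real n \<le> 4 ^ n" using n power_mono[of 2 "4 :: real" n] by simp
    then have "real n * B ^ n \<le> (4 * B) ^ n"
      unfolding power_mult_distrib using B by (intro mult_right_mono) auto
    then have "C * (real n * B ^ n) \<le> C * (4 * B) ^ n" using C by (intro mult_left_mono)
    with 1 show "(real n)\<^sup>2 + C * (real n * B ^ n) \<le> (C + 1) * (4 * B) ^ n"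
      by (simp add: algebra_simps)
  qed (use C B in auto)
  then show ?thesis unfolding has_exponential_isoperimetric_function_def
    using C B by (intro exI[of _ "C + 1"] exI[of _ "4 * B"]) auto
qed

theorem mainTheorem1:
  fixes V :: "'v set" and E :: "'v set set" and G :: "'v \<Rightarrow> ('a, 'm) monoid_scheme"
  assumes "finite_graph V E"
    and "\<And>i. i \<in> V \<Longrightarrow> Group.group (G i)"
    and "\<And>i. i \<in> V \<Longrightarrow> finitely_presented (G i)"
  shows "(\<forall>k > 1. (\<forall>i\<in>V. has_polynomial_isoperimetric_function (G i) k)
             \<longrightarrow> has_polynomial_isoperimetric_function (graph_product V E G) k)
       \<and> ((\<forall>i\<in>V. has_exponential_isoperimetric_function (G i))
             \<longrightarrow> has_exponential_isoperimetric_function (graph_product V E G))"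
  using graph_product_polynomial[OF assms(1), of G] graph_product_exponential[OF assms(1), of G]
    assms(2) by blast

end
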